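(* Let $\mathcal{A}$ be a Banach algebra such that $\mathrm{rad}(\mathcal{A})=\mathrm{rann}(\mathcal{A})$ and $\mathcal{A}/\mathrm{rad}(\mathcal{A})$ is commutative, and suppose $\mathcal{A}$ has a right identity. Then the following are equivalent: (i) $\mathcal{A}$ has an identity; (ii) every derivation of $\mathcal{A}$ is zero; (iii) every inner derivation of $\mathcal{A}$ is zero; (iv) $\mathcal{A}$ is commutative.
   Context: $\mathrm{rad}(\mathcal{A})$ is the Jacobson radical and $\mathrm{rann}(\mathcal{A})=\{c\in\mathcal{A}: ac=0\ \forall a\in\mathcal{A}\}$. A derivation is a linear map $d$ with $d(ab)=d(a)b+ad(b)$. For $a\in\mathcal{A}$ the inner derivation induced by $a$ is $d_a(b)=ba-ab$. *)

theory Defs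
  imports "HOL-Analysis.Analysis"
begin

class complex_banach_algebra = real_normed_algebra + banach +
  fixes scaleC :: "complex \<Rightarrow> 'a \<Rightarrow> 'a"
  assumes scaleC_of_real: "scaleC (complex_of_real r) x = scaleR r x"
    and scaleC_add_right: "scaleC c (x + y) = scaleC c x + scaleC c y"
    and scaleC_add_left: "scaleC (c + d) x = scaleC c x + scaleC d x"
    and scaleC_scaleC: "scaleC c (scaleC d x) = scaleC (c * d) x"
    and scaleC_one: "scaleC 1 x = x"
    and norm_scaleC: "norm (scaleC c x) = cmod c * norm x"
    and mult_scaleC_left: "scaleC c x * y = scaleC c (x * y)"
    and mult_scaleC_right: "x * scaleC c y = scaleC c (x * y)"

instantiation complex :: complex_banach_algebra
begin
definition scaleC_complex :: "complex \<Rightarrow> complex \<Rightarrow> complex" where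
  "scaleC_complex c x = c * x"
instance
  by standard (auto simp: scaleC_complex_def algebra_simps norm_mult scaleR_conv_of_real)
end

text \<open>Jacobson radical: a is in rad(A) iff b*a is (left) quasi-regular for every b,
  where x is left quasi-regular iff there is y with y + x - y*x = 0,
  i.e. (1 - y)(1 - x) = 1 in the unitization.\<close>

definition left_quasi_regular :: "'a::ring \<Rightarrow> bool" where
  "left_quasi_regular x \<longleftrightarrow> (\<exists>y. y + x - y * x = 0)"

definition jacobson_rad :: "'a::ring set" where
  "jacobson_rad = {a. \<forall>b. left_quasi_regular (b * a)}"

definition rann :: "'a::ring set" where
  "rann = {c. \<forall>a. a * c = 0}"

definition derivation :: "('a::complex_banach_algebra \<Rightarrow> 'a) \<Rightarrow> bool" where
  "derivation d \<longleftrightarrow>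
     (\<forall>x y. d (x + y) = d x + d y) \<and> (\<forall>c x. d (scaleC c x) = scaleC c (d x)) \<and>
     (\<forall>a b. d (a * b) = d a * b + a * d b)"

definition inner_derivation :: "'a::ring \<Rightarrow> 'a \<Rightarrow> 'a" where
  "inner_derivation a = (\<lambda>b. b * a - a * b)"

end

theory Submission
  imports Defs
begin

text \<open>
  The only hard implication is (i) \<open>\<Longrightarrow>\<close> (ii). An identity forces \<open>rad A = rann A = 0\<close>, so \<open>A\<close> is commutative and
  semisimple, and one has to show that a derivation \<open>D\<close>, not assumed continuous, vanishes
  (Johnson; Singer and Wermer).

  Characters separate the points of \<open>A\<close> by Gelfand--Mazur, which is proved with averages of the
  resolvent over roots of unity instead of Liouville's theorem. A sliding hump argument shows that
  \<open>\<phi> \<circ> D\<close> is unbounded for only finitely many characters \<open>\<phi>\<close>. The remaining ones still separate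
  points, since otherwise an exceptional \<open>\<phi>\<close> would be isolated by an idempotent, on which \<open>D\<close>
  vanishes. Hence \<open>D\<close> is bounded by the closed graph theorem. Finally \<open>\<phi> (D\<^sup>n (a\<^sup>n)) = n! \<phi> (D a)\<^sup>n\<close>
  whenever \<open>\<phi> a = 0\<close>, and boundedness of \<open>D\<close> makes the left-hand side grow only geometrically, so
  \<open>\<phi> \<circ> D = 0\<close> for every \<open>\<phi>\<close>.
\<close>

section \<open>The closed graph theorem\<close>

text \<open>By linearity, \<open>closed\<close> says that the graph of \<open>T\<close> is closed.
  Baire puts a ball inside some \<open>closure (B n)\<close>, so every vector is approximated
  arbitrarily well by vectors with controlled image. Iterating on the remainder gives a series whose
  sum \<open>closed\<close> identifies as \<open>T x\<close>.\<close>

lemma closed_graph_bounded: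
  fixes T :: "'a::banach \<Rightarrow> 'b::banach"
  assumes lin: "linear T"
    and closed: "\<And>X b. X \<longlonglongrightarrow> 0 \<Longrightarrow> (\<lambda>n. T (X n)) \<longlonglongrightarrow> b \<Longrightarrow> b = 0"
  shows "\<exists>K\<ge>0. \<forall>x. norm (T x) \<le> K * norm x"
proof -
  interpret T: linear T by fact
  define B where "B n = {x. norm (T x) \<le> real n}" for n :: nat
  have UN: "(\<Union>n. closure (B n)) = UNIV"
  proof -
    have "x \<in> closure (B (nat \<lceil>norm (T x)\<rceil>))" for x
      by (rule subsetD[OF closure_subset]) (auto simp: B_def intro: real_nat_ceiling_ge)
    then show ?thesis by blast
  qed
  have "\<exists>n. interior (closure (B n)) \<noteq> {}"
  proof (rule ccontr)
    assume "\<not> ?thesis"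
    then have "Met_TC.mtopology interior_of \<Union>(range (\<lambda>n. closure (B n))) = {}"
      by (intro Met_TC.metric_Baire_category_alt) (auto simp: complete_UNIV)
    then show False
      using UN by simp
  qed
  then obtain n c where "c \<in> interior (closure (B n))" by blast
  then obtain \<epsilon> where \<epsilon>: "\<epsilon> > 0" "ball c \<epsilon> \<subseteq> closure (B n)"
    unfolding mem_interior by blast
  \<comment> \<open>Differences of points of \<open>B n\<close> move the centre of the ball to 0, at
    the cost of doubling the bound.\<close>
  have small: "\<exists>u. norm (y - u) < \<eta> \<and> norm (T u) \<le> 2 * real n" if "norm y < \<epsilon>" "\<eta> > 0" for y \<eta>
  proof -
    have "c + y \<in> closure (B n)" "c \<in> closure (B n)"
      using \<epsilon> that by (auto simp: subset_iff dist_norm)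
    then obtain v w where v: "v \<in> B n" "dist v (c + y) < \<eta> / 2" and w: "w \<in> B n" "dist w c < \<eta> / 2"
      using \<open>\<eta> > 0\<close> by (meson closure_approachable half_gt_zero)
    have "norm (y - (v - w)) = norm ((w - c) - (v - (c + y)))"
      by (simp add: algebra_simps)
    also have "\<dots> \<le> norm (w - c) + norm (v - (c + y))"
      by (rule norm_triangle_ineq4)
    also have "\<dots> < \<eta>"
      using v w by (simp add: dist_norm)
    finally have "norm (y - (v - w)) < \<eta>" .
    moreover have "norm (T (v - w)) \<le> 2 * real n"
      using v w norm_triangle_ineq4[of "T v" "T w"] by (simp add: T.diff B_def)
    ultimately show ?thesis by blast
  qed
  \<comment> \<open>Rescaling \<open>y\<close> to norm \<open>\<epsilon> / 2\<close> turns the bound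
    \<open>2 * real n\<close> into \<open>2 * real n * (2 * norm y / \<epsilon>)\<close>.\<close>
  define K where "K = 4 * real n / \<epsilon>"
  have K: "K \<ge> 0" using \<epsilon> by (simp add: K_def)
  have approx: "\<exists>u. norm (y - u) < \<eta> \<and> norm (T u) \<le> K * norm y" if "\<eta> > 0" for y \<eta>
  proof (cases "y = 0")
    case True
    then show ?thesis using that by (intro exI[of _ 0]) (auto simp: T.zero)
  next
    case False
    define s where "s = \<epsilon> / (2 * norm y)"
    have s: "s > 0" using False \<epsilon> by (simp add: s_def)
    have "norm (s *\<^sub>R y) < \<epsilon>" using False \<epsilon> by (simp add: s_def)
    moreover have "s * \<eta> > 0" using s that by simp
    ultimately obtain u where u: "norm (s *\<^sub>R y - u) < s * \<eta>" "norm (T u) \<le> 2 * real n"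
      using small by blast
    have "s *\<^sub>R y - u = s *\<^sub>R (y - (1/s) *\<^sub>R u)"
      using s by (simp add: algebra_simps)
    then have "s * norm (y - (1/s) *\<^sub>R u) < s * \<eta>" using u(1) s by simp
    then have "norm (y - (1/s) *\<^sub>R u) < \<eta>" using s by simp
    moreover have "norm (T ((1/s) *\<^sub>R u)) \<le> K * norm y"
    proof -
      have "norm (T ((1/s) *\<^sub>R u)) = norm (T u) / s" using s by (simp add: T.scale)
      also have "\<dots> \<le> 2 * real n / s" using u(2) s by (intro divide_right_mono) auto
      also have "\<dots> = K * norm y" using False \<epsilon> by (simp add: s_def K_def field_simps)
      finally show ?thesis .
    qed
    ultimately show ?thesis by blast
  qed
  have "norm (T x) \<le> 2 * K * norm x" for x
  proof (cases "x = 0")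
    case True
    then show ?thesis by (simp add: T.zero)
  next
    case False
    \<comment> \<open>\<open>Y k\<close> is the remainder after \<open>k\<close> approximations. The
      clause for \<open>k = 0\<close> pins the start of the sequence to \<open>x\<close>.\<close>
    have "\<exists>Y. \<forall>k. (norm (Y k) \<le> norm x * (1/2)^k \<and> (k = 0 \<longrightarrow> Y k = x)) \<and>
        norm (T (Y k - Y (Suc k))) \<le> K * norm (Y k)"
    proof (rule dependent_nat_choice)
      fix y k
      assume "norm y \<le> norm x * (1/2)^k \<and> (k = 0 \<longrightarrow> y = x)"
      obtain u where u: "norm (y - u) < norm x * (1/2)^Suc k" "norm (T u) \<le> K * norm y"
        using approx[of "norm x * (1/2)^Suc k" y] False by auto
      then show "\<exists>z. (norm z \<le> norm x * (1/2)^Suc k \<and> (Suc k = 0 \<longrightarrow> z = x)) \<and> norm (T (y - z)) \<le> K * norm y"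
        by (intro exI[of _ "y - u"]) auto
    qed auto
    then obtain Y where Y: "\<And>k. norm (Y k) \<le> norm x * (1/2)^k" "Y 0 = x"
      and TY: "\<And>k. norm (T (Y k - Y (Suc k))) \<le> K * norm (Y k)" by metis
    define g where "g k = T (Y k - Y (Suc k))" for k
    have g: "norm (g k) \<le> (K * norm x) * (1/2)^k" for k
      using TY[of k] mult_left_mono[OF Y(1)[of k] K] by (simp add: g_def mult.assoc)
    have geo: "(\<lambda>k. (K * norm x) * (1/2)^k) sums ((K * norm x) * 2)"
      using sums_mult[OF geometric_sums[of "1/2::real"], of "K * norm x"] by simp
    have sg: "summable g"
      by (rule summable_comparison_test'[OF sums_summable[OF geo] g])
    have gle: "norm (suminf g) \<le> (K * norm x) * 2"
      using norm_suminf_le[OF g sums_summable[OF geo]] sums_unique[OF geo] by simp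
    have "(\<lambda>k. norm x * (1/2)^k) \<longlonglongrightarrow> 0"
      by (intro tendsto_mult_right_zero LIMSEQ_realpow_zero) auto
    then have Y0: "Y \<longlonglongrightarrow> 0"
      by (rule Lim_null_comparison[rotated]) (simp add: Y)
    have part: "(\<Sum>i<k. g i) = T x - T (Y k)" for k
      by (induction k) (auto simp: Y g_def T.diff)
    have "(\<lambda>k. T x - (\<Sum>i<k. g i)) \<longlonglongrightarrow> T x - suminf g"
      by (intro tendsto_intros summable_LIMSEQ sg)
    then have "(\<lambda>k. T (Y k)) \<longlonglongrightarrow> T x - suminf g"
      by (simp add: part)
    from closed[OF Y0 this] have "T x = suminf g" by simp
    then show ?thesis using gle by (simp add: mult_ac)
  qed
  then show ?thesis using K by (intro exI[of _ "2 * K"]) auto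
qed

section \<open>Algebra seminorms and the spectrum\<close>

lemma scaleC_zero_left [simp]: "scaleC 0 x = 0"
  using scaleC_of_real[of 0 x] by simp

lemma scaleC_zero_right [simp]: "scaleC c 0 = 0"
  using scaleC_add_right[of c 0 0] by simp

lemma scaleC_minus_right: "scaleC c (- x) = - scaleC c x"
  using scaleC_add_right[of c x "- x"] by (simp add: eq_neg_iff_add_eq_0 add.commute)

lemma scaleC_minus_left: "scaleC (- c) x = - scaleC c x"
  using scaleC_add_left[of c "- c" x] by (simp add: eq_neg_iff_add_eq_0 add.commute)

lemma scaleC_diff_right: "scaleC c (x - y) = scaleC c x - scaleC c y"
  using scaleC_add_right[of c x "- y"] by (simp add: scaleC_minus_right)

lemma scaleC_diff_left: "scaleC (c - d) x = scaleC c x - scaleC d x"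
  using scaleC_add_left[of c "- d" x] by (simp add: scaleC_minus_left)

lemma scaleC_sum_left: "scaleC (\<Sum>i\<in>I. f i) x = (\<Sum>i\<in>I. scaleC (f i) x)"
  by (induction I rule: infinite_finite_induct) (auto simp: scaleC_add_left)

lemmas scaleC_simps = scaleC_add_right scaleC_add_left scaleC_diff_right scaleC_diff_left
  scaleC_minus_right scaleC_minus_left scaleC_scaleC scaleC_one mult_scaleC_left mult_scaleC_right

text \<open>The identity is a locale parameter, so that the element provided by condition (i) can be
  plugged in. Its norm is not normalised to 1.\<close>

locale unital_comm_banach_algebra =
  fixes e :: "'a::complex_banach_algebra"
  assumes comm: "\<And>a b::'a. a * b = b * a"
    and unit_left [simp]: "\<And>a. e * a = a"
begin

lemma unit_right [simp]: "a * e = a"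
  using comm[of a e] by simp

lemma left_comm: "a * (b * c) = b * (a * (c::'a))"
  by (metis comm mult.assoc)

lemmas ring_simps = algebra_simps comm left_comm scaleC_simps

primrec pw :: "'a \<Rightarrow> nat \<Rightarrow> 'a" where
  "pw x 0 = e"
| "pw x (Suc n) = x * pw x n"

lemma pw_mult: "pw (x * y) n = pw x n * pw y n"
  by (induction n) (auto simp: ring_simps)

lemma pw_scaleC: "pw (scaleC c x) n = scaleC (c ^ n) (pw x n)"
  by (induction n) (auto simp: scaleC_simps mult.commute)

text \<open>The contraction \<open>y \<mapsto> e + x * y\<close> has a fixed point, and the fixed
  point equation is \<open>y * (e - x) = e\<close>.\<close>

lemma inverse_near_unit:
  assumes "norm x < 1"
  shows "\<exists>y. y * (e - x) = e"
proof -
  have "\<exists>!y. e + x * y = y"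
  proof (rule banach_fix_type[of "norm x"])
    show "\<forall>y z. dist (e + x * y) (e + x * z) \<le> norm x * dist y z"
      using norm_mult_ineq[of x] by (auto simp: dist_norm simp flip: right_diff_distrib)
  qed (use assms in auto)
  then obtain y where "e + x * y = y" by blast
  then have "y * (e - x) = e"
    by (simp add: ring_simps)
  then show ?thesis ..
qed

lemma geometric_telescope: "(e - x) * (\<Sum>j<n. pw x j) = e - pw x n"
  by (induction n) (simp_all add: distrib_left left_diff_distrib)

end

text \<open>Stands for the quotient algebra by the null space of \<open>p\<close>, without forming
  it: an equation \<open>x = y\<close> in the quotient reads \<open>p (x - y) = 0\<close>.\<close>

locale algebra_seminorm = unital_comm_banach_algebra e for e :: "'a::complex_banach_algebra" +
  fixes p :: "'a \<Rightarrow> real"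
  assumes p_add: "\<And>x y. p (x + y) \<le> p x + p y"
    and p_mult: "\<And>x y. p (x * y) \<le> p x * p y"
    and p_scaleC: "\<And>c x. p (scaleC c x) = cmod c * p x"
begin

lemma p_zero [simp]: "p 0 = 0"
  using p_scaleC[of 0 0] by simp

lemma p_minus [simp]: "p (- x) = p x"
  using p_scaleC[of "-1" x] by (simp add: scaleC_simps)

lemma p_nonneg: "p x \<ge> 0"
  using p_add[of x "- x"] by simp

lemma p_diff: "p (x - y) \<le> p x + p y"
  using p_add[of x "- y"] by simp

lemma p_sum: "p (\<Sum>i\<in>I. f i) \<le> (\<Sum>i\<in>I. p (f i))"
  by (induction I rule: infinite_finite_induct) (auto intro: order_trans[OF p_add])

lemma p_null_mult: "p x = 0 \<Longrightarrow> p (y * x) = 0"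
  using p_mult[of y x] p_nonneg[of "y * x"] by simp

lemma p_null_add: "p x = 0 \<Longrightarrow> p y = 0 \<Longrightarrow> p (x + y) = 0"
  using p_add[of x y] p_nonneg[of "x + y"] by simp

lemma p_null_diff: "p x = 0 \<Longrightarrow> p y = 0 \<Longrightarrow> p (x - y) = 0"
  using p_diff[of x y] p_nonneg[of "x - y"] by simp

lemma p_null_sum: "(\<And>i. i \<in> I \<Longrightarrow> p (f i) = 0) \<Longrightarrow> p (\<Sum>i\<in>I. f i) = 0"
  by (induction I rule: infinite_finite_induct) (auto intro: p_null_add)

lemma p_cong: "p (x - y) = 0 \<Longrightarrow> p x = p y"
  using p_add[of "x - y" y] p_diff[of x "x - y"] by simp

text \<open>The averages over the \<open>n\<close>-th roots of unity are the inverses of \<open>e - r^n a^n\<close>, so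
  equicontinuity in \<open>r\<close> propagates the decay of \<open>r^n a^n\<close> from \<open>r = 0\<close> up to \<open>r = 1\<close>.\<close>

lemma resolvent_everywhere_imp_power_bounded:
  assumes inv: "\<And>z. \<exists>q. p (q * (e - scaleC z a) - e) = 0"
  shows "eventually (\<lambda>n. p (pw a n) \<le> 1) sequentially"
proof -
  obtain Q where Q: "\<And>z. p (Q z * (e - scaleC z a) - e) = 0"
    using inv by metis
  \<comment> \<open>The resolvent identity: modulo the null space, \<open>Q z - Q w\<close> is
    \<open>(z - w) a (Q z) (Q w)\<close>.\<close>
  have Qdiff: "p (Q z - Q w) \<le> cmod (z - w) * (p a * (p (Q z) * p (Q w)))" for z w
  proof -
    have "p ((Q z - Q w) - scaleC (z - w) (a * (Q z * Q w))) =
        p (Q w * (Q z * (e - scaleC z a) - e) - Q z * (Q w * (e - scaleC w a) - e))"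
      by (rule arg_cong[where f = p]) (simp add: ring_simps)
    also have "\<dots> = 0"
      by (intro p_null_diff p_null_mult Q)
    finally have "p (Q z - Q w) = cmod (z - w) * p (a * (Q z * Q w))"
      by (simp add: p_cong p_scaleC)
    also have "p (a * (Q z * Q w)) \<le> p a * (p (Q z) * p (Q w))"
      by (meson p_mult p_nonneg mult_left_mono order_trans)
    finally show ?thesis
      by (simp add: mult_left_mono)
  qed
  \<comment> \<open>Nothing bounds \<open>Q z\<close> beforehand. For \<open>z\<close> close to
    \<open>w\<close> the difference is at most half of \<open>p (Q z)\<close> and is absorbed on the
    left; compactness of the disc then makes the bound uniform.\<close>
  have Qloc: "p (Q z) \<le> 2 * p (Q w)" if "cmod (z - w) * (p a * p (Q w)) \<le> 1/2" for z w
  proof -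
    have "p (Q z) \<le> p (Q w) + p (Q z - Q w)"
      using p_add[of "Q w" "Q z - Q w"] by simp
    also have "p (Q z - Q w) \<le> (cmod (z - w) * (p a * p (Q w))) * p (Q z)"
      using Qdiff[of z w] by (simp add: mult_ac)
    also have "\<dots> \<le> 1/2 * p (Q z)"
      by (intro mult_right_mono that p_nonneg)
    finally show ?thesis by simp
  qed
  have "\<exists>B. \<forall>z\<in>cball 0 1. p (Q z) \<le> B"
  proof -
    define \<delta> where "\<delta> w = 1 / (2 * (p a * p (Q w) + 1))" for w
    have pos: "p a * p (Q w) + 1 > 0" for w
      using mult_nonneg_nonneg[OF p_nonneg[of a] p_nonneg[of "Q w"]] by linarith
    have \<delta>: "\<delta> w > 0" for w using pos[of w] by (simp add: \<delta>_def)
    obtain W where W: "W \<subseteq> cball 0 1" "finite W" "cball 0 1 \<subseteq> (\<Union>w\<in>W. ball w (\<delta> w))"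
      by (rule compactE_image[of "cball (0::complex) 1" "cball 0 1" "\<lambda>w. ball w (\<delta> w)"])
        (use \<delta> in force)+
    have "p (Q z) \<le> (\<Sum>w\<in>W. 2 * p (Q w))" if "z \<in> cball 0 1" for z
    proof -
      obtain w where w: "w \<in> W" "z \<in> ball w (\<delta> w)" using W(3) \<open>z \<in> cball 0 1\<close> by blast
      have "cmod (z - w) * (p a * p (Q w)) \<le> \<delta> w * (p a * p (Q w) + 1)"
        using w pos[of w] \<delta>[of w]
        by (intro mult_mono) (auto simp: dist_norm norm_minus_commute p_nonneg)
      also have "\<dots> = 1/2" using pos[of w] by (simp add: \<delta>_def)
      finally have "p (Q z) \<le> 2 * p (Q w)" by (rule Qloc)
      also have "\<dots> \<le> (\<Sum>w\<in>W. 2 * p (Q w))"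
        using w W(2) by (intro member_le_sum) (auto simp: p_nonneg)
      finally show ?thesis .
    qed
    then show ?thesis by blast
  qed
  then obtain B where B: "\<And>z. cmod z \<le> 1 \<Longrightarrow> p (Q z) \<le> B"
    by (auto simp: Ball_def)
  have B0: "B \<ge> 0" using B[of 0] p_nonneg[of "Q 0"] by simp
  define K where "K = p a * (B * B)"
  have K0: "K \<ge> 0" by (simp add: K_def p_nonneg B0)
  have Qlip: "p (Q z - Q w) \<le> K * cmod (z - w)" if "cmod z \<le> 1" "cmod w \<le> 1" for z w
  proof -
    have "p a * (p (Q z) * p (Q w)) \<le> K"
      unfolding K_def by (intro mult_left_mono mult_mono B that p_nonneg B0)
    then show ?thesis
      using Qdiff[of z w] mult_left_mono[of _ K "cmod (z - w)"] by (fastforce simp: mult.commute)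
  qed
  define \<omega> where "\<omega> n k = cis (2 * pi * real k / real n)" for n k :: nat
  define Av where "Av n r = scaleC (1 / of_nat n) (\<Sum>k<n. Q (of_real r * \<omega> n k))" for n and r :: real
  define x where "x n r = scaleC (of_real (r ^ n)) (pw a n)" for n and r :: real
  have px: "p (x n r) = r ^ n * p (pw a n)" if "r \<ge> 0" for n r
    using that by (simp add: x_def p_scaleC norm_power)
  have \<omega>_sum: "(\<Sum>k<n. \<omega> n k ^ j) = (if j = 0 then of_nat n else 0)" if "j < n" for n j
  proof (cases "j = 0")
    case False
    let ?c = "cis (2 * pi * real j / real n)"
    have "\<omega> n k ^ j = ?c ^ k" for k
      unfolding \<omega>_def Complex.DeMoivre by (rule arg_cong[where f = cis]) simp
    then have "(\<Sum>k<n. \<omega> n k ^ j) = (\<Sum>k<n. ?c ^ k)" by simp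
    moreover have "?c ^ n = 1"
      using that unfolding Complex.DeMoivre by (simp add: cis_multiple_2pi)
    moreover have "?c \<noteq> 1"
    proof
      assume "?c = 1"
      then have "?c = cis (2 * pi * real 0 / real n)" by simp
      then show False
        using inj_onD[OF bij_betw_imp_inj_on[OF Complex.bij_betw_roots_unity[of n]], of j 0] that False by simp
    qed
    ultimately show ?thesis
      using geometric_sum[of ?c n] False by simp
  qed (use that in simp)
  \<comment> \<open>Since \<open>?z k ^ n = r ^ n\<close>, the factor
    \<open>e - scaleC (?z k) a\<close> divides \<open>e - x n r\<close> with cofactor
    \<open>?s k\<close>. Hence \<open>Q (?z k) * (e - x n r)\<close> is \<open>?s k\<close> modulo
    the null space, and orthogonality of the roots of unity makes the cofactors average to
    \<open>e\<close>.\<close>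
  have Av_inv: "p (Av n r * (e - x n r) - e) = 0" if "n > 0" for n r
  proof -
    let ?z = "\<lambda>k. of_real r * \<omega> n k"
    let ?s = "\<lambda>k. \<Sum>j<n. pw (scaleC (?z k) a) j"
    have zn: "?z k ^ n = of_real (r ^ n)" for k
      using that unfolding power_mult_distrib \<omega>_def Complex.DeMoivre by (simp add: cis_multiple_2pi)
    have tel: "e - x n r = (e - scaleC (?z k) a) * ?s k" for k
      unfolding geometric_telescope by (simp only: pw_scaleC zn x_def)
    have "(\<Sum>k<n. ?s k) = (\<Sum>k<n. \<Sum>j<n. scaleC (of_real r ^ j * \<omega> n k ^ j) (pw a j))"
      by (simp add: pw_scaleC power_mult_distrib)
    also have "\<dots> = (\<Sum>j<n. \<Sum>k<n. scaleC (of_real r ^ j * \<omega> n k ^ j) (pw a j))"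
      by (rule sum.swap)
    also have "\<dots> = (\<Sum>j<n. scaleC (of_real r ^ j * (if j = 0 then of_nat n else 0)) (pw a j))"
    proof (rule sum.cong[OF refl])
      fix j assume "j \<in> {..<n}"
      then have "(\<Sum>k<n. of_real r ^ j * \<omega> n k ^ j) = of_real r ^ j * (if j = 0 then of_nat n else 0)"
        by (simp only: \<omega>_sum sum_distrib_left[symmetric] lessThan_iff)
      then show "(\<Sum>k<n. scaleC (of_real r ^ j * \<omega> n k ^ j) (pw a j))
          = scaleC (of_real r ^ j * (if j = 0 then of_nat n else 0)) (pw a j)"
        by (simp only: scaleC_sum_left[symmetric])
    qed
    also have "\<dots> = (\<Sum>j\<in>{0::nat}. scaleC (of_nat n) e)"
      using that by (intro sum.mono_neutral_cong_right) auto
    finally have ssum: "scaleC (1 / of_nat n) (\<Sum>k<n. ?s k) = e"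
      using that by (simp add: scaleC_scaleC scaleC_one)
    have "p (\<Sum>k<n. Q (?z k) * (e - x n r) - ?s k) = 0"
    proof (rule p_null_sum)
      fix k
      have "Q (?z k) * (e - x n r) - ?s k = ?s k * (Q (?z k) * (e - scaleC (?z k) a) - e)"
        unfolding tel[of k] by (simp only: right_diff_distrib left_diff_distrib comm left_comm unit_left unit_right mult.assoc)
      then show "p (Q (?z k) * (e - x n r) - ?s k) = 0"
        by (simp only: p_null_mult Q)
    qed
    then have "p (scaleC (1 / of_nat n) (\<Sum>k<n. Q (?z k) * (e - x n r) - ?s k)) = 0"
      by (simp add: p_scaleC)
    also have "scaleC (1 / of_nat n) (\<Sum>k<n. Q (?z k) * (e - x n r) - ?s k) = Av n r * (e - x n r) - e"
      unfolding sum_subtractf scaleC_diff_right ssum Av_def mult_scaleC_left sum_distrib_right ..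
    finally show ?thesis .
  qed
  have Av_lip: "p (Av n r - Av n s) \<le> K * \<bar>r - s\<bar>" if "n > 0" "0 \<le> r" "r \<le> 1" "0 \<le> s" "s \<le> 1" for n r s
  proof -
    have "p (Av n r - Av n s) = (1 / n) * p (\<Sum>k<n. Q (of_real r * \<omega> n k) - Q (of_real s * \<omega> n k))"
      by (simp add: Av_def sum_subtractf p_scaleC norm_divide flip: scaleC_diff_right)
    also have "\<dots> \<le> (1 / n) * (\<Sum>k<n. p (Q (of_real r * \<omega> n k) - Q (of_real s * \<omega> n k)))"
      by (intro mult_left_mono p_sum) auto
    also have "\<dots> \<le> (1 / n) * (\<Sum>k<n. K * \<bar>r - s\<bar>)"
    proof (intro mult_left_mono sum_mono)
      fix k
      have "p (Q (of_real r * \<omega> n k) - Q (of_real s * \<omega> n k)) \<le> K * cmod (of_real r * \<omega> n k - of_real s * \<omega> n k)"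
        using that by (intro Qlip) (auto simp: norm_mult \<omega>_def)
      also have "cmod (of_real r * \<omega> n k - of_real s * \<omega> n k) = \<bar>r - s\<bar>"
        by (simp add: norm_mult \<omega>_def flip: left_diff_distrib of_real_diff)
      finally show "p (Q (of_real r * \<omega> n k) - Q (of_real s * \<omega> n k)) \<le> K * \<bar>r - s\<bar>" .
    qed auto
    also have "\<dots> = K * \<bar>r - s\<bar>" using that by simp
    finally show ?thesis .
  qed
  \<comment> \<open>With \<open>Av n r\<close> the inverse of \<open>e - x n r\<close>, each of
    \<open>x n r\<close> and \<open>Av n r - e\<close> is at most twice the other in
    \<open>p\<close>, as long as the other is at most 1/2. This estimate and \<open>d_le\<close> are
    the two directions.\<close>
  have x_le: "p (x n r) \<le> 2 * p (Av n r - e)" if "n > 0" "p (Av n r - e) \<le> 1/2" for n r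
  proof -
    let ?d = "Av n r - e"
    have "p (x n r - (?d - x n r * ?d)) = p (- (Av n r * (e - x n r) - e))"
      by (rule arg_cong[where f = p]) (simp add: ring_simps)
    then have "p (x n r) = p (?d - x n r * ?d)"
      by (intro p_cong) (simp only: p_minus Av_inv that)
    also have "\<dots> \<le> p ?d + p (x n r) * p ?d"
      by (meson p_diff p_mult add_left_mono order_trans)
    also have "\<dots> \<le> p ?d + p (x n r) * (1/2)"
      using that by (intro add_left_mono mult_left_mono p_nonneg) auto
    finally show ?thesis by simp
  qed
  have d_le: "p (Av n r - e) \<le> 2 * p (x n r)" if "n > 0" "p (x n r) \<le> 1/2" for n r
  proof -
    let ?d = "Av n r - e"
    have "p (?d - (x n r + x n r * ?d)) = p (Av n r * (e - x n r) - e)"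
      by (rule arg_cong[where f = p]) (simp add: ring_simps)
    then have "p ?d = p (x n r + x n r * ?d)"
      by (intro p_cong) (simp only: Av_inv that)
    also have "\<dots> \<le> p (x n r) + p (x n r) * p ?d"
      by (meson p_add p_mult add_left_mono order_trans)
    also have "\<dots> \<le> p (x n r) + 1/2 * p ?d"
      using that by (intro add_left_mono mult_right_mono p_nonneg) auto
    finally show ?thesis by simp
  qed
  let ?T = "\<lambda>s. (\<lambda>n. s ^ n * p (pw a n)) \<longlonglongrightarrow> 0"
  let ?P = "\<lambda>r. eventually (\<lambda>n. r ^ n * p (pw a n) \<le> 1) sequentially"
  \<comment> \<open>Decay at \<open>s\<close> gives \<open>p (x n s) < 1/8\<close>, so
    \<open>d_le\<close> gives 1/4. Moving from \<open>s\<close> to \<open>r\<close> adds at most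
    1/4, and \<open>x_le\<close> turns the total 1/2 into the bound 1.\<close>
  have step: "?P r" if "?T s" "0 \<le> s" "s \<le> r" "r \<le> 1" "K * (r - s) \<le> 1/4" for r s
  proof -
    have "eventually (\<lambda>n. s ^ n * p (pw a n) < 1/8) sequentially"
      using order_tendstoD(2)[OF that(1), of "1/8"] by simp
    then show ?thesis
      using eventually_gt_at_top[of 0]
    proof eventually_elim
      case (elim n)
      then have "p (x n s) < 1/8" using px[of s n] that by simp
      then have "p (Av n s - e) \<le> 1/4" using d_le[of n s] elim by simp
      moreover have "p (Av n r - Av n s) \<le> 1/4"
        using Av_lip[of n r s] elim that by simp
      ultimately have d: "p (Av n r - e) \<le> 1/2"
        using p_add[of "Av n r - Av n s" "Av n s - e"] by simp
      then have "p (x n r) \<le> 1" using x_le[of n r] elim by simp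
      then show ?case using px[of r n] that by simp
    qed
  qed
  have decay: "?T s" if "?P r" "0 \<le> s" "s < r" for r s
  proof -
    have "(\<lambda>n. (s / r) ^ n) \<longlonglongrightarrow> 0"
      using that by (intro LIMSEQ_power_zero) simp
    moreover have "eventually (\<lambda>n. norm (s ^ n * p (pw a n)) \<le> (s / r) ^ n) sequentially"
      using that(1)
    proof eventually_elim
      case (elim n)
      have "s ^ n * p (pw a n) = (s / r) ^ n * (r ^ n * p (pw a n))"
        using that by (simp add: power_divide)
      also have "\<dots> \<le> (s / r) ^ n * 1"
        using that elim by (intro mult_left_mono) auto
      finally show ?case using that by (simp add: p_nonneg)
    qed
    ultimately show ?thesis
      by (rule Lim_null_comparison[rotated])
  qed
  obtain N :: nat where N: "8 * K < real N" using reals_Archimedean2 by blast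
  then have "N > 0" using K0 by (auto intro: gr0I)
  note N = N this
  have KN: "K * (2 / real N) \<le> 1/4" "K * (1 / real N) \<le> 1/4" using N K0 by (auto simp: field_simps)
  \<comment> \<open>Each round advances two mesh points, to boundedness at
    \<open>(j + 2) / N\<close>, and gives one back, because \<open>decay\<close> holds only strictly
    below. At radius 1 only boundedness is obtained.\<close>
  have T: "j < N \<Longrightarrow> ?T (real j / real N)" for j
  proof (induction j)
    case 0
    have "eventually (\<lambda>n. (0::real) ^ n * p (pw a n) = 0) sequentially"
      using eventually_gt_at_top[of 0] by eventually_elim simp
    then show ?case by (simp add: tendsto_eventually)
  next
    case (Suc j)
    define r where "r = min 1 (real (j + 2) / real N)"
    have r: "r = real (j + 2) / real N"
      using Suc.prems by (simp add: r_def)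
    have "r \<le> 1" by (simp add: r_def)
    moreover have "r - real j / real N = 2 / real N"
      by (simp add: r field_simps flip: diff_divide_distrib)
    ultimately have "?P r"
      using Suc KN N by (intro step[of "real j / real N"]) (auto simp: r divide_right_mono)
    then show ?case
      using N by (intro decay[of r]) (auto simp: r divide_strict_right_mono)
  qed
  have "?P 1"
  proof (rule step)
    show "?T (real (N - 1) / real N)" using N by (intro T) auto
    show "K * (1 - real (N - 1) / real N) \<le> 1/4"
      using KN N by (simp add: of_nat_diff field_simps)
  qed (use N in auto)
  then show ?thesis by simp
qed

text \<open>If every \<open>a - scaleC c e\<close> were invertible modulo the null space, then
  \<open>e - scaleC z x\<close> would be invertible for all \<open>z\<close>, both for
  \<open>x = 2a\<close> and for \<open>x\<close> the inverse of \<open>a\<close>. The powers of both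
  are then eventually bounded by 1, but their products are \<open>2 ^ n\<close> times the
  identity.\<close>

lemma spectrum_nonempty:
  assumes "p e > 0"
  shows "\<exists>c. \<forall>q. p (q * (a - scaleC c e) - e) \<noteq> 0"
proof (rule ccontr)
  assume "\<not> ?thesis"
  then obtain R where R: "\<And>c. p (R c * (a - scaleC c e) - e) = 0" by metis
  have 1: "\<exists>q. p (q * (e - scaleC z (scaleC 2 a)) - e) = 0" for z
  proof (cases "z = 0")
    case True
    then show ?thesis by (intro exI[of _ e]) simp
  next
    case False
    let ?c = "1 / (2 * z)"
    have "scaleC (- ?c) (R ?c) * (e - scaleC z (scaleC 2 a)) - e = R ?c * (a - scaleC ?c e) - e"
      using False by (simp add: ring_simps)
    then show ?thesis using R by metis
  qed
  \<comment> \<open>In the quotient \<open>R 0\<close> inverts \<open>a\<close>, so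
    \<open>e - scaleC z (R 0)\<close> is \<open>R 0 * (a - scaleC z e)\<close>, with inverse
    \<open>R z * a\<close>.\<close>
  have 2: "\<exists>q. p (q * (e - scaleC z (R 0)) - e) = 0" for z
  proof -
    have "R z * a * (e - scaleC z (R 0)) - e
        = (R z * (a - scaleC z e) - e) - scaleC z (R z) * (R 0 * (a - scaleC 0 e) - e)"
      by (simp add: ring_simps)
    then show ?thesis using R by (metis p_null_diff p_null_mult)
  qed
  have "eventually (\<lambda>n. 2 ^ n * p e \<le> 1) sequentially"
    using resolvent_everywhere_imp_power_bounded[OF 1] resolvent_everywhere_imp_power_bounded[OF 2]
  proof eventually_elim
    case (elim n)
    have Rn: "p (pw (R 0 * a) n - e) = 0" for n
    proof (induction n)
      case (Suc n)
      have "pw (R 0 * a) (Suc n) - e = (R 0 * a) * (pw (R 0 * a) n - e) + (R 0 * (a - scaleC 0 e) - e)"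
        by (simp add: ring_simps)
      then show ?case using Suc R by (metis p_null_add p_null_mult)
    qed simp
    have "2 ^ n * p e = p (scaleC (2 ^ n) (pw (R 0 * a) n))"
      using p_cong[OF Rn] by (simp add: p_scaleC norm_power)
    also have "\<dots> = p (pw (scaleC 2 a) n * pw (R 0) n)"
      by (simp add: pw_scaleC pw_mult ring_simps)
    also have "\<dots> \<le> p (pw (scaleC 2 a) n) * p (pw (R 0) n)" by (rule p_mult)
    also have "\<dots> \<le> 1 * 1" using elim by (intro mult_mono) (auto simp: p_nonneg)
    finally show ?case by simp
  qed
  then obtain m where m: "\<And>n. n \<ge> m \<Longrightarrow> 2 ^ n * p e \<le> 1"
    by (auto simp: eventually_sequentially)
  obtain k where "1 / p e < 2 ^ k"
    using real_arch_pow[of 2 "1 / p e"] by auto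
  also have "(2::real) ^ k \<le> 2 ^ (max m k)"
    by (rule power_increasing) auto
  finally show False
    using m[of "max m k"] assms by (simp add: field_simps)
qed

end

section \<open>Maximal ideals and characters\<close>

context unital_comm_banach_algebra
begin

definition proper_ideal :: "'a set \<Rightarrow> bool" where
  "proper_ideal M \<longleftrightarrow> 0 \<in> M \<and> (\<forall>x\<in>M. \<forall>y\<in>M. x + y \<in> M) \<and> (\<forall>x\<in>M. \<forall>y. y * x \<in> M) \<and> e \<notin> M"

definition maximal_ideal :: "'a set \<Rightarrow> bool" where
  "maximal_ideal M \<longleftrightarrow> proper_ideal M \<and> (\<forall>N. proper_ideal N \<longrightarrow> M \<subseteq> N \<longrightarrow> N = M)"

definition character :: "('a \<Rightarrow> complex) \<Rightarrow> bool" where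
  "character \<phi> \<longleftrightarrow> (\<forall>x y. \<phi> (x + y) = \<phi> x + \<phi> y) \<and> (\<forall>c x. \<phi> (scaleC c x) = c * \<phi> x) \<and>
     (\<forall>x y. \<phi> (x * y) = \<phi> x * \<phi> y) \<and> \<phi> e = 1"

lemma proper_idealD:
  assumes "proper_ideal M"
  shows "0 \<in> M" "x \<in> M \<Longrightarrow> y \<in> M \<Longrightarrow> x + y \<in> M" "x \<in> M \<Longrightarrow> y * x \<in> M"
    "x \<in> M \<Longrightarrow> scaleC c x \<in> M" "x \<in> M \<Longrightarrow> y \<in> M \<Longrightarrow> x - y \<in> M" "e \<notin> M"
proof -
  show *: "0 \<in> M" "e \<notin> M" "\<And>x y. x \<in> M \<Longrightarrow> y \<in> M \<Longrightarrow> x + y \<in> M" "\<And>x y. x \<in> M \<Longrightarrow> y * x \<in> M"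
    using assms by (auto simp: proper_ideal_def)
  show sc: "scaleC c x \<in> M" if "x \<in> M" for c x
    using *(4)[OF that, of "scaleC c e"] by (simp add: scaleC_simps)
  show "x - y \<in> M" if "x \<in> M" "y \<in> M"
    using *(3)[OF that(1) sc[OF that(2), of "-1"]] by (simp add: scaleC_simps)
qed

lemma proper_ideal_principal:
  assumes "\<And>z. z * x \<noteq> e"
  shows "proper_ideal (range (\<lambda>z. z * x))"
  unfolding proper_ideal_def
proof (intro conjI ballI allI)
  show "0 \<in> range (\<lambda>z. z * x)" by (rule image_eqI[of _ _ 0]) auto
  show "e \<notin> range (\<lambda>z. z * x)" using assms by (metis imageE)
next
  fix a b assume "a \<in> range (\<lambda>z. z * x)" "b \<in> range (\<lambda>z. z * x)"
  then show "a + b \<in> range (\<lambda>z. z * x)" by (auto simp flip: distrib_right)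
next
  fix a y assume "a \<in> range (\<lambda>z. z * x)"
  then show "y * a \<in> range (\<lambda>z. z * x)" by (auto simp flip: mult.assoc)
qed

lemma maximal_ideal_exists:
  assumes "proper_ideal I"
  shows "\<exists>M. maximal_ideal M \<and> I \<subseteq> M"
proof -
  let ?A = "{N. proper_ideal N \<and> I \<subseteq> N}"
  have "\<exists>M\<in>?A. \<forall>X\<in>?A. M \<subseteq> X \<longrightarrow> X = M"
  proof (rule subset_Zorn_nonempty)
    show "?A \<noteq> {}" using assms by blast
    fix \<C> assume ne: "\<C> \<noteq> {}" and ch: "subset.chain ?A \<C>"
    have C: "proper_ideal N" "I \<subseteq> N" if "N \<in> \<C>" for N
      using ch that by (auto simp: subset.chain_def)
    have "x + y \<in> \<Union>\<C>" if xy: "x \<in> \<Union>\<C>" "y \<in> \<Union>\<C>" for x y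
    proof -
      obtain X Y where XY: "X \<in> \<C>" "x \<in> X" "Y \<in> \<C>" "y \<in> Y" using xy by blast
      have "X \<subseteq> Y \<or> Y \<subseteq> X" using ch XY unfolding subset_chain_def by blast
      then show ?thesis using XY C proper_idealD(2) by blast
    qed
    then have "proper_ideal (\<Union>\<C>)"
      using ne C unfolding proper_ideal_def by blast
    then show "\<Union>\<C> \<in> ?A" using ne C by blast
  qed
  then obtain M where M: "M \<in> ?A" and max: "\<forall>X\<in>?A. M \<subseteq> X \<longrightarrow> X = M" by (rule bexE)
  have "maximal_ideal M"
    unfolding maximal_ideal_def
  proof (intro conjI allI impI)
    fix N assume "proper_ideal N" "M \<subseteq> N"
    moreover from this have "N \<in> ?A" using M by auto
    ultimately show "N = M" using max by simp
  qed (use M in simp)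
  with M show ?thesis by auto
qed

text \<open>Otherwise \<open>M + A x\<close> would be a strictly larger proper ideal.\<close>

lemma maximal_ideal_inverse:
  assumes M: "maximal_ideal M" and "x \<notin> M"
  shows "\<exists>y. y * x - e \<in> M"
proof (rule ccontr)
  assume no: "\<not> ?thesis"
  have pM: "proper_ideal M" using M by (simp add: maximal_ideal_def)
  let ?N = "{m + y * x | m y. m \<in> M}"
  have "proper_ideal ?N"
    unfolding proper_ideal_def
  proof (intro conjI ballI allI)
    show "0 \<in> ?N" using proper_idealD(1)[OF pM] by (intro CollectI exI[of _ 0]) auto
    show "e \<notin> ?N"
    proof
      assume "e \<in> ?N"
      then obtain m y where my: "m \<in> M" "e = m + y * x" by blast
      then have "y * x - e = scaleC (-1) m" by (simp add: scaleC_simps)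
      then show False using no my proper_idealD(4)[OF pM] by metis
    qed
  next
    fix a b assume "a \<in> ?N" "b \<in> ?N"
    then obtain m y m' y' where "m \<in> M" "a = m + y * x" "m' \<in> M" "b = m' + y' * x" by blast
    then show "a + b \<in> ?N"
      using proper_idealD(2)[OF pM] by (intro CollectI exI[of _ "m + m'"] exI[of _ "y + y'"]) (auto simp: algebra_simps)
  next
    fix a z assume "a \<in> ?N"
    then obtain m y where "m \<in> M" "a = m + y * x" by blast
    then show "z * a \<in> ?N"
      using proper_idealD(3)[OF pM] by (intro CollectI exI[of _ "z * m"] exI[of _ "z * y"]) (auto simp: algebra_simps)
  qed
  moreover have "M \<subseteq> ?N"
    by (force intro: exI[of _ 0])
  moreover have "x \<in> ?N"
    using proper_idealD(1)[OF pM] by (intro CollectI exI[of _ 0] exI[of _ e]) auto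
  ultimately show False using M \<open>x \<notin> M\<close> unfolding maximal_ideal_def by blast
qed

text \<open>Elements at distance less than 1 from \<open>e\<close> are invertible. This keeps
  \<open>e\<close> out of the closure of a proper ideal, so that maximality forces maximal ideals to
  be closed.\<close>

lemma norm_unit_diff_ge_1:
  assumes "proper_ideal M" "x \<in> M"
  shows "norm (e - x) \<ge> 1"
proof (rule ccontr)
  assume "\<not> ?thesis"
  then obtain y where "y * (e - (e - x)) = e" using inverse_near_unit[of "e - x"] by auto
  then show False using proper_idealD(3)[OF assms, of y] proper_idealD(6)[OF assms(1)] by simp
qed

lemma maximal_ideal_closed:
  assumes M: "maximal_ideal M"
  shows "closed M"
proof -
  have pM: "proper_ideal M" using M by (simp add: maximal_ideal_def)
  have "proper_ideal (closure M)"
    unfolding proper_ideal_def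
  proof (intro conjI ballI allI)
    show "0 \<in> closure M" using proper_idealD(1)[OF pM] closure_subset by blast
    show "e \<notin> closure M"
    proof
      assume "e \<in> closure M"
      then obtain x where "x \<in> M" "dist x e < 1" by (meson closure_approachable zero_less_one)
      then show False using norm_unit_diff_ge_1[OF pM] by (fastforce simp: dist_norm norm_minus_commute)
    qed
  next
    fix x y assume "x \<in> closure M" "y \<in> closure M"
    then obtain X Y where "\<And>n. X n \<in> M" "X \<longlonglongrightarrow> x" "\<And>n. Y n \<in> M" "Y \<longlonglongrightarrow> y"
      unfolding closure_sequential by blast
    then show "x + y \<in> closure M"
      unfolding closure_sequential
      by (intro exI[of _ "\<lambda>n. X n + Y n"]) (auto intro!: tendsto_intros proper_idealD(2)[OF pM])
  next
    fix x y assume "x \<in> closure M"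
    then obtain X where "\<And>n. X n \<in> M" "X \<longlonglongrightarrow> x"
      unfolding closure_sequential by blast
    then show "y * x \<in> closure M"
      unfolding closure_sequential
      by (intro exI[of _ "\<lambda>n. y * X n"]) (auto intro!: tendsto_intros proper_idealD(3)[OF pM])
  qed
  then have "closure M = M" using M closure_subset unfolding maximal_ideal_def by blast
  then show ?thesis by (metis closed_closure)
qed

text \<open>The distance to \<open>M\<close> is the quotient norm of A/M; this makes the spectral
  argument available modulo \<open>M\<close>.\<close>

lemma quotient_seminorm:
  assumes pM: "proper_ideal M"
  shows "algebra_seminorm e (\<lambda>x. infdist x M)"
proof
  note D = proper_idealD[OF pM]
  have ne: "M \<noteq> {}" using D(1) by blast
  have approx: "\<exists>m\<in>M. norm (x - m) < infdist x M + \<epsilon>" if "\<epsilon> > 0" for x \<epsilon>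
  proof (rule ccontr)
    assume "\<not> ?thesis"
    then have "infdist x M + \<epsilon> \<le> infdist x M"
      unfolding infdist_notempty[OF ne, of x] using ne
      by (intro cINF_greatest) (auto simp: dist_norm not_less)
    then show False using that by simp
  qed
  show "infdist (x + y) M \<le> infdist x M + infdist y M" for x y
  proof (rule field_le_epsilon)
    fix \<epsilon> :: real assume "\<epsilon> > 0"
    then obtain m n where m: "m \<in> M" "norm (x - m) < infdist x M + \<epsilon>/2"
      and n: "n \<in> M" "norm (y - n) < infdist y M + \<epsilon>/2"
      using approx half_gt_zero by meson
    have "infdist (x + y) M \<le> norm ((x - m) + (y - n))"
      using infdist_le[OF D(2)[OF m(1) n(1)], of "x + y"] by (simp add: dist_norm algebra_simps)
    also have "\<dots> \<le> norm (x - m) + norm (y - n)" by (rule norm_triangle_ineq)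
    finally show "infdist (x + y) M \<le> infdist x M + infdist y M + \<epsilon>" using m n by simp
  qed
  show "infdist (x * y) M \<le> infdist x M * infdist y M" for x y
  proof -
    have "infdist (x * y) M \<le> (infdist x M + \<epsilon>) * (infdist y M + \<epsilon>)" if "\<epsilon> > 0" for \<epsilon>
    proof -
      obtain m n where m: "m \<in> M" "norm (x - m) < infdist x M + \<epsilon>"
        and n: "n \<in> M" "norm (y - n) < infdist y M + \<epsilon>"
        using approx \<open>\<epsilon> > 0\<close> by meson
      \<comment> \<open>This element is \<open>x * y - (x - m) * (y - n)\<close>.\<close>
      have "x * n + (y - n) * m \<in> M" using m n D(2,3) by blast
      from infdist_le[OF this, of "x * y"] have "infdist (x * y) M \<le> norm ((x - m) * (y - n))"
        by (simp add: dist_norm ring_simps)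
      also have "\<dots> \<le> norm (x - m) * norm (y - n)" by (rule norm_mult_ineq)
      also have "\<dots> \<le> (infdist x M + \<epsilon>) * (infdist y M + \<epsilon>)"
        using m n that by (intro mult_mono) (auto intro: add_nonneg_nonneg infdist_nonneg)
      finally show ?thesis .
    qed
    then have "eventually (\<lambda>\<epsilon>. infdist (x * y) M \<le> (infdist x M + \<epsilon>) * (infdist y M + \<epsilon>)) (at_right 0)"
      by (auto simp: eventually_at_right_less intro: eventually_mono[OF eventually_at_right_less])
    moreover have "((\<lambda>\<epsilon>. (infdist x M + \<epsilon>) * (infdist y M + \<epsilon>)) \<longlongrightarrow> (infdist x M + 0) * (infdist y M + 0)) (at_right 0)"
      by (intro tendsto_intros)
    ultimately show ?thesis
      using tendsto_lowerbound[of _ _ "at_right (0::real)"] by fastforce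
  qed
  \<comment> \<open>The reverse inequality comes from this one, applied to \<open>1 / c\<close> and
    \<open>scaleC c x\<close>.\<close>
  have le: "infdist (scaleC c x) M \<le> cmod c * infdist x M" for c x
  proof (rule field_le_epsilon)
    fix \<epsilon> :: real assume "\<epsilon> > 0"
    then have "\<epsilon> / (cmod c + 1) > 0" by (simp add: add_nonneg_pos)
    then obtain m where m: "m \<in> M" "norm (x - m) < infdist x M + \<epsilon> / (cmod c + 1)"
      using approx by meson
    have "infdist (scaleC c x) M \<le> cmod c * norm (x - m)"
      using infdist_le[OF D(4)[OF m(1), of c], of "scaleC c x"]
      by (simp add: dist_norm norm_scaleC flip: scaleC_diff_right)
    also have "\<dots> \<le> cmod c * (infdist x M + \<epsilon> / (cmod c + 1))"
      using m by (intro mult_left_mono) auto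
    also have "\<dots> \<le> cmod c * infdist x M + \<epsilon>"
    proof -
      have "\<epsilon> * (cmod c / (cmod c + 1)) \<le> \<epsilon> * 1"
        using \<open>\<epsilon> > 0\<close> by (intro mult_left_mono) (auto simp: divide_le_eq_1 add_nonneg_pos)
      then show ?thesis by (simp add: algebra_simps)
    qed
    finally show "infdist (scaleC c x) M \<le> cmod c * infdist x M + \<epsilon>" .
  qed
  show "infdist (scaleC c x) M = cmod c * infdist x M" for c x
  proof (cases "c = 0")
    case True
    then show ?thesis using D(1) by simp
  next
    case False
    have "infdist x M \<le> cmod (1 / c) * infdist (scaleC c x) M"
      using le[of "1 / c" "scaleC c x"] False by (simp add: scaleC_simps)
    then show ?thesis
      using le[of c x] False by (simp add: norm_divide field_simps)
  qed
qed

text \<open>Gelfand--Mazur for A/M: a point \<open>c\<close> of the spectrum of \<open>x\<close>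
  makes \<open>x - scaleC c e\<close> non-invertible modulo \<open>M\<close>, hence a member of
  \<open>M\<close>. Uniqueness of \<open>c\<close> makes the assignment of \<open>c\<close> to
  \<open>x\<close> an algebra homomorphism.\<close>

lemma maximal_ideal_character:
  assumes M: "maximal_ideal M"
  shows "\<exists>\<phi>. character \<phi> \<and> (\<forall>x\<in>M. \<phi> x = 0)"
proof -
  have pM: "proper_ideal M" using M by (simp add: maximal_ideal_def)
  note D = proper_idealD[OF pM]
  interpret algebra_seminorm e "\<lambda>x. infdist x M" by (rule quotient_seminorm[OF pM])
  have zero: "infdist x M = 0 \<longleftrightarrow> x \<in> M" for x
    using in_closed_iff_infdist_zero[OF maximal_ideal_closed[OF M]] D(1) by blast
  have "infdist e M > 0"
    using zero[of e] D(6) infdist_nonneg[of e M] by linarith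
  then have "\<exists>c. x - scaleC c e \<in> M" for x
    using spectrum_nonempty[of x] maximal_ideal_inverse[OF M] unfolding zero by blast
  then obtain \<phi> where \<phi>: "\<And>x. x - scaleC (\<phi> x) e \<in> M" by metis
  have uniq: "c = \<phi> x" if "x - scaleC c e \<in> M" for c x
  proof (rule ccontr)
    assume ne: "c \<noteq> \<phi> x"
    have "(x - scaleC (\<phi> x) e) - (x - scaleC c e) \<in> M" using \<phi> that D(5) by blast
    then have "scaleC (c - \<phi> x) e \<in> M" by (simp add: scaleC_diff_left)
    then have "scaleC (1 / (c - \<phi> x)) (scaleC (c - \<phi> x) e) \<in> M" by (rule D(4))
    then show False using ne D(6) by (simp add: scaleC_scaleC scaleC_one)
  qed
  have "character \<phi>"
    unfolding character_def
  proof (intro conjI allI)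
    fix x y c
    have "(x + y) - scaleC (\<phi> x + \<phi> y) e = (x - scaleC (\<phi> x) e) + (y - scaleC (\<phi> y) e)"
      by (simp add: ring_simps)
    then show "\<phi> (x + y) = \<phi> x + \<phi> y" using uniq \<phi> D(2) by metis
    have "scaleC c x - scaleC (c * \<phi> x) e = scaleC c (x - scaleC (\<phi> x) e)"
      by (simp add: ring_simps)
    then show "\<phi> (scaleC c x) = c * \<phi> x" using uniq \<phi> D(4) by metis
    have "x * y - scaleC (\<phi> x * \<phi> y) e
        = x * (y - scaleC (\<phi> y) e) + scaleC (\<phi> y) (x - scaleC (\<phi> x) e)"
      by (simp add: ring_simps)
    then show "\<phi> (x * y) = \<phi> x * \<phi> y" using uniq \<phi> D(2,3,4) by metis
    show "\<phi> e = 1" using uniq[of e 1] D(1) by (simp add: scaleC_one)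
  qed
  moreover have "\<phi> x = 0" if "x \<in> M" for x
    using uniq[of x 0] that by simp
  ultimately show ?thesis by blast
qed

section \<open>Continuity of characters and separation of points\<close>

lemma characterD:
  assumes "character \<phi>"
  shows "\<phi> (x + y) = \<phi> x + \<phi> y" "\<phi> (scaleC c x) = c * \<phi> x" "\<phi> (x * y) = \<phi> x * \<phi> y" "\<phi> e = 1"
    "\<phi> 0 = 0" "\<phi> (- x) = - \<phi> x" "\<phi> (x - y) = \<phi> x - \<phi> y"
proof -
  show *: "\<phi> (x + y) = \<phi> x + \<phi> y" "\<phi> (scaleC c x) = c * \<phi> x" "\<phi> (x * y) = \<phi> x * \<phi> y" "\<phi> e = 1" for x y c
    using assms by (auto simp: character_def)
  show "\<phi> 0 = 0" using *(2)[of 0 0] by simp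
  show m: "\<phi> (- x) = - \<phi> x" for x using *(2)[of "-1" x] by (simp add: scaleC_simps)
  show "\<phi> (x - y) = \<phi> x - \<phi> y" using *(1)[of x "- y"] by (simp add: m)
qed

text \<open>If \<open>norm x < cmod (\<phi> x)\<close>, then
  \<open>e - scaleC (1 / \<phi> x) x\<close> is invertible although \<open>\<phi>\<close> kills
  it.\<close>

lemma character_bound:
  assumes \<phi>: "character \<phi>"
  shows "cmod (\<phi> x) \<le> norm x"
proof (rule ccontr)
  assume "\<not> ?thesis"
  then have lt: "norm x < cmod (\<phi> x)" by simp
  then have nz: "\<phi> x \<noteq> 0" by (metis norm_ge_zero norm_zero not_less)
  have "norm (scaleC (1 / \<phi> x) x) < 1" using lt nz by (simp add: norm_scaleC norm_divide)
  then obtain y where "y * (e - scaleC (1 / \<phi> x) x) = e" using inverse_near_unit by blast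
  then have "\<phi> y * (1 - (1 / \<phi> x) * \<phi> x) = 1" using characterD[OF \<phi>] by metis
  then show False using nz by simp
qed

text \<open>As \<open>a\<close> is outside the radical, some \<open>e - b * a\<close> is not
  invertible. It lies in a maximal ideal, whose character satisfies
  \<open>\<phi> (b * a) = 1\<close>.\<close>

lemma character_separates:
  assumes rad: "jacobson_rad \<subseteq> {0::'a}" and "a \<noteq> 0"
  shows "\<exists>\<phi>. character \<phi> \<and> \<phi> a \<noteq> 0"
proof -
  obtain b where b: "\<not> left_quasi_regular (b * a)"
    using assms by (auto simp: jacobson_rad_def)
  have "z * (e - b * a) \<noteq> e" for z
  proof
    assume "z * (e - b * a) = e"
    \<comment> \<open>An inverse \<open>z\<close> of \<open>e - b * a\<close> corresponds to the
      quasi-inverse \<open>e - z\<close>.\<close>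
    then have "(e - z) + b * a - (e - z) * (b * a) = 0" by (simp add: algebra_simps)
    then show False using b unfolding left_quasi_regular_def by blast
  qed
  then obtain M where M: "maximal_ideal M" "range (\<lambda>z. z * (e - b * a)) \<subseteq> M"
    using maximal_ideal_exists[OF proper_ideal_principal] by blast
  then obtain \<phi> where \<phi>: "character \<phi>" "\<And>x. x \<in> M \<Longrightarrow> \<phi> x = 0"
    using maximal_ideal_character by blast
  have "e * (e - b * a) \<in> M" using M by blast
  then have "\<phi> (e - b * a) = 0" using \<phi>(2) by simp
  then have "\<phi> a \<noteq> 0" using characterD[OF \<phi>(1)] by auto
  then show ?thesis using \<phi> by blast
qed

end

section \<open>Derivations\<close>

lemma derivationD:
  assumes "derivation D"
  shows "D (x + y) = D x + D y" "D (scaleC c x) = scaleC c (D x)" "D (x * y) = D x * y + x * D y"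
    "D 0 = 0" "D (x - y) = D x - D y"
proof -
  show *: "D (x + y) = D x + D y" "D (scaleC c x) = scaleC c (D x)" "D (x * y) = D x * y + x * D y" for x y c
    using assms by (auto simp: derivation_def)
  show "D 0 = 0" using *(2)[of 0 0] by simp
  show "D (x - y) = D x - D y" using *(1)[of "x - y" y] by simp
qed

lemma derivation_linear:
  assumes "derivation D"
  shows "linear D"
  by (rule linearI) (simp_all add: derivationD[OF assms] flip: scaleC_of_real)

context unital_comm_banach_algebra
begin

text \<open>Multiplying \<open>D f = f * D f + f * D f\<close> by \<open>f\<close> shows that
  \<open>f * D f\<close> equals its own double.\<close>

lemma derivation_idempotent:
  fixes D :: "'a \<Rightarrow> 'a"
  assumes D: "derivation D" and idem: "f * f = f"
  shows "f * D f = 0"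
proof -
  have "D f = f * D f + f * D f"
    using derivationD(3)[OF D, of f f] comm[of "D f" f] by (simp add: idem)
  then have "f * D f = f * (f * D f + f * D f)" by simp
  also have "\<dots> = f * D f + f * D f"
    by (simp add: distrib_left idem flip: mult.assoc)
  finally show ?thesis by simp
qed

lemma derivation_unit: "derivation D \<Longrightarrow> D e = 0"
  using derivation_idempotent[of D e] by simp

lemma derivation_pw_Suc:
  assumes D: "derivation D"
  shows "D (pw a (Suc n)) = scaleC (of_nat (Suc n)) (pw a n * D a)"
proof (induction n)
  case 0
  show ?case by (simp add: derivationD[OF D] derivation_unit[OF D] scaleC_one)
next
  case (Suc n)
  have "D (pw a (Suc (Suc n))) = D a * pw a (Suc n) + a * D (pw a (Suc n))"
    by (simp add: derivationD[OF D])
  also have "\<dots> = pw a (Suc n) * D a + scaleC (of_nat (Suc n)) (pw a (Suc n) * D a)"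
    unfolding Suc by (simp only: pw.simps mult_scaleC_right mult.assoc comm left_comm)
  also have "\<dots> = scaleC (of_nat (Suc (Suc n))) (pw a (Suc n) * D a)"
    by (simp only: of_nat_Suc[of "Suc n"] scaleC_add_left scaleC_one)
  finally show ?case .
qed

text \<open>The extra factor \<open>g\<close> makes the induction go through: one application of
  \<open>D\<close> leaves \<open>pw a n\<close> times \<open>(n + 1) (D a) g + a (D g)\<close>. The
  induction hypothesis applies to both summands, and the second vanishes because
  \<open>\<phi> a = 0\<close>.\<close>

lemma character_derivation_funpow:
  assumes \<phi>: "character \<phi>" and D: "derivation D" and a: "\<phi> a = 0"
  shows "\<phi> ((D ^^ n) (pw a n * g)) = fact n * \<phi> (D a) ^ n * \<phi> g"
proof (induction n arbitrary: g)
  case (Suc n)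
  have add: "(D ^^ n) (x + y) = (D ^^ n) x + (D ^^ n) y" for x y
    by (induction n) (auto simp: derivationD[OF D])
  have "D (pw a (Suc n) * g) = D (pw a (Suc n)) * g + pw a (Suc n) * D g"
    by (rule derivationD(3)[OF D])
  also have "\<dots> = pw a n * scaleC (of_nat (Suc n)) (D a * g) + pw a n * (a * D g)"
    unfolding derivation_pw_Suc[OF D] by (simp add: ring_simps)
  finally have "(D ^^ Suc n) (pw a (Suc n) * g)
      = (D ^^ n) (pw a n * scaleC (of_nat (Suc n)) (D a * g)) + (D ^^ n) (pw a n * (a * D g))"
    by (simp add: funpow_swap1 add)
  then show ?case
    by (simp only: characterD[OF \<phi>] Suc a) (simp add: algebra_simps)
qed (simp add: characterD[OF \<phi>])

section \<open>Bounded derivations\<close>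

lemma norm_pw_le: "norm (pw x n) \<le> norm x ^ n * norm e"
proof (induction n)
  case (Suc n)
  have "norm (pw x (Suc n)) \<le> norm x * norm (pw x n)" by (simp add: norm_mult_ineq)
  also have "\<dots> \<le> norm x * (norm x ^ n * norm e)" by (intro mult_left_mono Suc) auto
  finally show ?case by (simp add: mult_ac)
qed simp

lemma bounded_derivation_character:
  assumes \<phi>: "character \<phi>" and D: "derivation D"
    and K: "K \<ge> 0" "\<And>x. norm (D x) \<le> K * norm x"
  shows "\<phi> (D b) = 0"
proof (rule ccontr)
  assume nz: "\<phi> (D b) \<noteq> 0"
  \<comment> \<open>Subtracting a multiple of \<open>e\<close> achieves \<open>\<phi> a = 0\<close>
    and leaves \<open>D b\<close> unchanged, because \<open>D e = 0\<close>.\<close>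
  define a where "a = b - scaleC (\<phi> b) e"
  have a0: "\<phi> a = 0" by (simp add: a_def characterD[OF \<phi>])
  have Da: "D a = D b" by (simp add: a_def derivationD[OF D] derivation_unit[OF D])
  define t where "t = cmod (\<phi> (D a))"
  have t: "t > 0" using nz by (simp add: t_def Da)
  have iter: "norm ((D ^^ n) x) \<le> K ^ n * norm x" for n x
  proof (induction n)
    case (Suc n)
    have "norm ((D ^^ Suc n) x) \<le> K * norm ((D ^^ n) x)" using K(2) by simp
    also have "\<dots> \<le> K * (K ^ n * norm x)" by (intro mult_left_mono Suc K)
    finally show ?case by (simp add: mult_ac)
  qed simp
  define c where "c = K * norm a / t"
  have "fact n \<le> c ^ n * norm e" for n :: nat
  proof -
    have "fact n * t ^ n = cmod (\<phi> ((D ^^ n) (pw a n * e)))"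
      unfolding character_derivation_funpow[OF \<phi> D a0]
      by (simp add: norm_mult norm_power t_def characterD[OF \<phi>])
    also have "\<dots> \<le> norm ((D ^^ n) (pw a n * e))" by (rule character_bound[OF \<phi>])
    also have "\<dots> \<le> K ^ n * norm (pw a n)" using iter[of n "pw a n"] by simp
    also have "\<dots> \<le> K ^ n * (norm a ^ n * norm e)"
      using K by (intro mult_left_mono norm_pw_le) auto
    finally show ?thesis
      using t by (simp add: c_def power_divide power_mult_distrib field_simps)
  qed
  then have ge: "1 \<le> (inverse (fact n) * c ^ n) * norm e" for n :: nat
    by (simp add: field_simps)
  have "(\<lambda>n. inverse (fact n) * c ^ n) \<longlonglongrightarrow> 0"
    by (rule summable_LIMSEQ_zero[OF summable_exp])
  then have "(\<lambda>n. (inverse (fact n) * c ^ n) * norm e) \<longlonglongrightarrow> 0"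
    by (rule tendsto_mult_left_zero)
  from LIMSEQ_le_const[OF this, of 1] ge show False by auto
qed

text \<open>Supplies the multipliers of the sliding hump. Once \<open>\<phi> k\<close> and
  \<open>w k\<close> are chosen, all later characters are drawn from an infinite set of characters
  not vanishing at \<open>w k\<close>.\<close>

lemma character_separating_sequence:
  assumes inf: "infinite E" and E: "\<And>\<phi>. \<phi> \<in> E \<Longrightarrow> character \<phi>"
  shows "\<exists>\<phi> w. \<forall>k::nat. \<phi> k \<in> E \<and> norm (w k) \<le> 1 \<and> \<phi> k (w k) = 0 \<and> (\<forall>j>k. \<phi> j (w k) \<noteq> 0)"
proof -
  have split: "\<exists>\<phi>\<in>S. \<exists>w S'. norm w \<le> 1 \<and> \<phi> w = 0 \<and> infinite S' \<and> S' \<subseteq> S \<and> (\<forall>\<psi>\<in>S'. \<psi> w \<noteq> 0)"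
    if S: "infinite S" "S \<subseteq> E" for S
  proof -
    \<comment> \<open>Take distinct \<open>\<phi>\<close>, \<open>\<psi>\<close> and
      \<open>w\<close> with \<open>\<phi> w = 0\<close> and \<open>\<psi> w \<noteq> 0\<close>. If
      only finitely many characters in \<open>S\<close> are nonzero at \<open>w\<close>, then
      \<open>v = w - scaleC (\<psi> w) e\<close> is killed by \<open>\<psi>\<close> and takes the
      nonzero value \<open>- \<psi> w\<close> at all the others.\<close>
    have "\<exists>\<phi>\<in>S. \<exists>w. \<phi> w = 0 \<and> infinite {\<psi>\<in>S. \<psi> w \<noteq> 0}"
    proof -
      obtain \<phi> where \<phi>: "\<phi> \<in> S" using S(1) by fastforce
      obtain \<psi> where \<psi>: "\<psi> \<in> S" "\<psi> \<noteq> \<phi>"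
        using S(1) by (metis finite.emptyI finite.insertI finite_subset insertCI subsetI)
      then obtain x where x: "\<psi> x \<noteq> \<phi> x" by blast
      note c\<phi> = characterD[OF E[OF subsetD[OF S(2) \<phi>]]]
      define w where "w = x - scaleC (\<phi> x) e"
      have w: "\<phi> w = 0" by (simp add: w_def c\<phi>)
      show ?thesis
      proof (cases "infinite {\<psi>\<in>S. \<psi> w \<noteq> 0}")
        case True
        then show ?thesis using \<phi> w by blast
      next
        case False
        note c\<psi> = characterD[OF E[OF subsetD[OF S(2) \<psi>(1)]]]
        define v where "v = w - scaleC (\<psi> w) e"
        have "\<psi> w \<noteq> 0" using x by (simp add: w_def c\<psi>)
        moreover have "\<forall>\<xi>\<in>S. \<xi> v = \<xi> w - \<psi> w"
        proof
          fix \<xi> assume "\<xi> \<in> S"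
          note characterD[OF E[OF subsetD[OF S(2) this]]]
          then show "\<xi> v = \<xi> w - \<psi> w" by (simp add: v_def)
        qed
        ultimately have "S - {\<xi>\<in>S. \<xi> w \<noteq> 0} \<subseteq> {\<xi>\<in>S. \<xi> v \<noteq> 0}" by auto
        then have "infinite {\<xi>\<in>S. \<xi> v \<noteq> 0}"
          using False S(1) by (meson Diff_infinite_finite finite_subset)
        moreover have "\<psi> v = 0" by (simp add: v_def c\<psi>)
        ultimately show ?thesis using \<psi> by blast
      qed
    qed
    then obtain \<phi> w where \<phi>: "\<phi> \<in> S" "\<phi> w = 0" "infinite {\<psi>\<in>S. \<psi> w \<noteq> 0}" by blast
    define c where "c = 1 / (1 + norm w)"
    have c: "c > 0" by (simp add: c_def add_pos_nonneg)
    have sc: "\<xi> (scaleC (of_real c) w) = of_real c * \<xi> w" if "\<xi> \<in> S" for \<xi>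
      using characterD(2)[OF E[OF subsetD[OF S(2) that]]] .
    have "norm (scaleC (of_real c) w) \<le> 1"
      unfolding scaleC_of_real using c by (simp add: c_def divide_le_eq_1 add_pos_nonneg)
    moreover have "\<phi> (scaleC (of_real c) w) = 0" using sc[OF \<phi>(1)] \<phi>(2) by simp
    moreover have "\<forall>\<psi>\<in>{\<psi>\<in>S. \<psi> w \<noteq> 0}. \<psi> (scaleC (of_real c) w) \<noteq> 0"
    proof
      fix \<psi> assume "\<psi> \<in> {\<psi>\<in>S. \<psi> w \<noteq> 0}"
      then show "\<psi> (scaleC (of_real c) w) \<noteq> 0" using sc[of \<psi>] c by simp
    qed
    ultimately show ?thesis using \<phi> by blast
  qed
  \<comment> \<open>A stage consists of the chosen character and element, with the reservoir
    \<open>S\<close> for all later choices.\<close>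
  define P where "P = (\<lambda>(S, \<phi>, w::'a). infinite S \<and> S \<subseteq> E \<and> \<phi> \<in> E \<and> norm w \<le> 1 \<and> \<phi> w = 0 \<and>
      (\<forall>\<psi>\<in>S. \<psi> w \<noteq> 0))"
  have "\<exists>F. \<forall>n. P (F n) \<and> (fst (F (Suc n)) \<subseteq> fst (F n) \<and> fst (snd (F (Suc n))) \<in> fst (F n))"
  proof (rule dependent_nat_choice)
    show "\<exists>x. P x"
      using split[OF inf order_refl] unfolding P_def by auto
    fix x n assume "P x"
    then have S: "infinite (fst x)" "fst x \<subseteq> E" by (auto simp: P_def)
    from split[OF S] obtain \<phi> where \<phi>: "\<phi> \<in> fst x"
      "\<exists>w S'. norm w \<le> 1 \<and> \<phi> w = 0 \<and> infinite S' \<and> S' \<subseteq> fst x \<and> (\<forall>\<psi>\<in>S'. \<psi> w \<noteq> 0)"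
      by (rule bexE)
    from \<phi>(2) obtain w S' where
      "norm w \<le> 1 \<and> \<phi> w = 0 \<and> infinite S' \<and> S' \<subseteq> fst x \<and> (\<forall>\<psi>\<in>S'. \<psi> w \<noteq> 0)"
      by (elim exE)
    then show "\<exists>y. P y \<and> fst y \<subseteq> fst x \<and> fst (snd y) \<in> fst x"
      using S \<phi>(1) by (intro exI[of _ "(S', \<phi>, w)"]) (auto simp: P_def)
  qed
  then obtain F where F: "\<And>n. P (F n)" "\<And>n. fst (F (Suc n)) \<subseteq> fst (F n)"
    "\<And>n. fst (snd (F (Suc n))) \<in> fst (F n)" by blast
  have dec: "fst (F j) \<subseteq> fst (F k)" if "k \<le> j" for j k
    using that by (induction rule: dec_induct) (use F(2) in auto)
  have mem: "fst (snd (F j)) \<in> fst (F k)" if "k < j" for j k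
  proof -
    obtain i where i: "j = Suc i" using \<open>k < j\<close> by (cases j) auto
    then have "fst (F i) \<subseteq> fst (F k)" using \<open>k < j\<close> by (intro dec) simp
    then show ?thesis using F(3)[of i] i by (simp add: subset_iff)
  qed
  show ?thesis
  proof (intro exI allI conjI impI)
    fix k
    show "fst (snd (F k)) \<in> E" "norm (snd (snd (F k))) \<le> 1" "fst (snd (F k)) (snd (snd (F k))) = 0"
      using F(1)[of k] by (auto simp: P_def split_beta)
    show "fst (snd (F j)) (snd (snd (F k))) \<noteq> 0" if "j > k" for j
      using F(1)[of k] mem[OF that] by (auto simp: P_def split_beta)
  qed
qed

text \<open>A sliding hump: the element \<open>b = x\<^sub>0 + w\<^sub>0\<^sup>2 (x\<^sub>1 + w\<^sub>1\<^sup>2 (x\<^sub>2 + \<dots>))\<close> is built so that the part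
  beyond \<open>x\<^sub>k\<close> is divisible by \<open>w\<^sub>k\<^sup>2\<close> and hence invisible to \<open>\<phi>\<^sub>k \<circ> D\<close>.\<close>

lemma finite_unbounded_characters:
  assumes D: "derivation D"
  shows "finite {\<phi>. character \<phi> \<and> \<not> (\<exists>K. \<forall>x. cmod (\<phi> (D x)) \<le> K * norm x)}" (is "finite ?E")
proof (rule ccontr)
  assume "infinite ?E"
  moreover define E where "E = ?E"
  ultimately have "\<exists>\<phi> w. \<forall>k::nat. \<phi> k \<in> E \<and> norm (w k) \<le> 1 \<and> \<phi> k (w k) = 0 \<and> (\<forall>j>k. \<phi> j (w k) \<noteq> 0)"
    by (intro character_separating_sequence) simp_all
  then obtain \<phi> w where
    seq: "\<forall>k::nat. \<phi> k \<in> E \<and> norm (w k) \<le> 1 \<and> \<phi> k (w k) = 0 \<and> (\<forall>j>k. \<phi> j (w k) \<noteq> 0)"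
    by (elim exE)
  have E: "\<phi> k \<in> E" and w1: "norm (w k) \<le> 1" and w0: "\<phi> k (w k) = 0"
    and wn: "k < j \<Longrightarrow> \<phi> j (w k) \<noteq> 0" for j k
    using seq by auto
  have ch: "character (\<phi> k)" for k using E[of k] by (simp add: E_def)
  \<comment> \<open>\<open>V k\<close> is the product of the squares of \<open>w 0\<close> up to
    \<open>w (k - 1)\<close>; no \<open>\<phi> j\<close> with \<open>j \<ge> k\<close> kills
    it.\<close>
  define V where "V = rec_nat e (\<lambda>k v. v * (w k * w k))"
  have V: "V 0 = e" "V (Suc k) = V k * (w k * w k)" for k by (simp_all add: V_def)
  have Vn: "k \<le> j \<Longrightarrow> \<phi> j (V k) \<noteq> 0" for j k
    by (induction k) (auto simp: V characterD[OF ch] wn)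
  \<comment> \<open>Multiplying by \<open>V k\<close> keeps \<open>\<phi> k \<circ> D\<close>
    unbounded: by the product rule, \<open>\<phi> k (D (V k * x))\<close> is the nonzero multiple
    \<open>\<phi> k (V k) * \<phi> k (D x)\<close> plus a term bounded in \<open>x\<close>.\<close>
  have hump: "\<exists>x. norm x \<le> \<epsilon> \<and> C \<le> cmod (\<phi> k (D (V k * x)))" if "\<epsilon> > 0" for k \<epsilon> C
  proof (rule ccontr)
    assume "\<not> ?thesis"
    then have lt: "cmod (\<phi> k (D (V k * x))) < C" if "norm x \<le> \<epsilon>" for x using that by force
    define B where "B = (C + cmod (\<phi> k (D (V k))) * \<epsilon>) / (cmod (\<phi> k (V k)) * \<epsilon>)"
    have Vk: "cmod (\<phi> k (V k)) > 0" using Vn[of k k] by simp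
    have small: "cmod (\<phi> k (D x)) \<le> B * \<epsilon>" if "norm x \<le> \<epsilon>" for x
    proof -
      have "\<phi> k (V k) * \<phi> k (D x) = \<phi> k (D (V k * x)) - \<phi> k (D (V k)) * \<phi> k x"
        by (simp add: derivationD[OF D] characterD[OF ch])
      then have "cmod (\<phi> k (V k)) * cmod (\<phi> k (D x)) \<le> cmod (\<phi> k (D (V k * x))) + cmod (\<phi> k (D (V k))) * cmod (\<phi> k x)"
        by (metis norm_mult norm_triangle_ineq4)
      also have "\<dots> \<le> C + cmod (\<phi> k (D (V k))) * \<epsilon>"
        using lt[OF that] character_bound[OF ch, of k x] that by (intro add_mono mult_left_mono) auto
      finally have "cmod (\<phi> k (D x)) \<le> (C + cmod (\<phi> k (D (V k))) * \<epsilon>) / cmod (\<phi> k (V k))"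
        using Vk by (simp add: pos_le_divide_eq mult.commute)
      also have "\<dots> = B * \<epsilon>" using \<open>\<epsilon> > 0\<close> by (simp add: B_def)
      finally show ?thesis .
    qed
    have "cmod (\<phi> k (D x)) \<le> B * norm x" for x
    proof (cases "x = 0")
      case True
      then show ?thesis by (simp add: derivationD[OF D] characterD[OF ch])
    next
      case False
      define s where "s = \<epsilon> / norm x"
      have s: "s > 0" using False that by (simp add: s_def)
      have "cmod (\<phi> k (D (scaleC (of_real s) x))) \<le> B * \<epsilon>"
        using False that s by (intro small) (simp add: scaleC_of_real, simp add: s_def)
      then have "s * cmod (\<phi> k (D x)) \<le> B * \<epsilon>"
        using s by (simp add: derivationD[OF D] characterD[OF ch] norm_mult)
      then show ?thesis using False that by (simp add: s_def field_simps)
    qed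
    then show False using E[of k] unfolding E_def by blast
  qed
  \<comment> \<open>\<open>F k\<close> pairs the partial sum built before stage \<open>k\<close>
    with the new term, which is chosen so that its contribution exceeds that of the partial sum by
    at least \<open>k\<close>.\<close>
  have "\<exists>F. \<forall>k. ((k = 0 \<longrightarrow> fst (F k) = 0) \<and> norm (snd (F k)) \<le> (1/2)^k \<and>
      real k + cmod (\<phi> k (D (fst (F k)))) \<le> cmod (\<phi> k (D (V k * snd (F k))))) \<and>
      fst (F (Suc k)) = fst (F k) + V k * snd (F k)"
  proof (rule dependent_nat_choice)
    show "\<exists>y. (0 = (0::nat) \<longrightarrow> fst y = 0) \<and> norm (snd y) \<le> (1/2)^0 \<and>
      real 0 + cmod (\<phi> 0 (D (fst y))) \<le> cmod (\<phi> 0 (D (V 0 * snd y)))"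
      using hump[of 1 "cmod (\<phi> 0 (D 0))" 0] by auto
    fix y and k :: nat
    obtain x where "norm x \<le> (1/2)^Suc k"
      "real (Suc k) + cmod (\<phi> (Suc k) (D (fst y + V k * snd y))) \<le> cmod (\<phi> (Suc k) (D (V (Suc k) * x)))"
      using hump[where k = "Suc k" and \<epsilon> = "(1/2)^Suc k"] by (meson half_gt_zero zero_less_one zero_less_power)
    then show "\<exists>z. ((Suc k = 0 \<longrightarrow> fst z = 0) \<and> norm (snd z) \<le> (1/2)^Suc k \<and>
        real (Suc k) + cmod (\<phi> (Suc k) (D (fst z))) \<le> cmod (\<phi> (Suc k) (D (V (Suc k) * snd z)))) \<and>
        fst z = fst y + V k * snd y"
      by (intro exI[of _ "(fst y + V k * snd y, x)"]) auto
  qed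
  then obtain F where F: "\<And>k. norm (snd (F k)) \<le> (1/2)^k" "fst (F 0) = 0"
     "\<And>k. real k + cmod (\<phi> k (D (fst (F k)))) \<le> cmod (\<phi> k (D (V k * snd (F k))))"
     "\<And>k. fst (F (Suc k)) = fst (F k) + V k * snd (F k)" by auto
  define s x where "s = (\<lambda>k. fst (F k))" and "x = (\<lambda>k. snd (F k))"
  have s0: "s 0 = 0" and s_Suc: "\<And>k. s (Suc k) = s k + V k * x k" and x_le: "\<And>k. norm (x k) \<le> (1/2)^k"
    and big: "\<And>k. real k + cmod (\<phi> k (D (s k))) \<le> cmod (\<phi> k (D (V k * x k)))"
    using F by (auto simp: s_def x_def)
  \<comment> \<open>\<open>U i k\<close> is the product of the squares of \<open>w k\<close> up to
    \<open>w (k + i - 1)\<close>, so that \<open>b k\<close> below is the inner bracket of the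
    nested series starting at \<open>x k\<close>.\<close>
  define U where "U = rec_nat (\<lambda>k. e) (\<lambda>i u k. w k * w k * u (Suc k))"
  have U: "U 0 k = e" "U (Suc i) k = w k * w k * U i (Suc k)" for i k by (simp_all add: U_def)
  have U_le: "norm (U i k) \<le> norm e" for i k
  proof (induction i arbitrary: k)
    case (Suc i)
    have "norm (U (Suc i) k) \<le> (norm (w k) * norm (w k)) * norm (U i (Suc k))"
      unfolding U by (meson norm_mult_ineq mult_right_mono norm_ge_zero order_trans)
    also have "\<dots> \<le> (1 * 1) * norm e"
      by (intro mult_mono w1 Suc) auto
    finally show ?case by simp
  qed (simp add: U)
  define g where "g k i = x (k + i) * U i k" for k i
  have g_sum: "summable (g k)" for k
  proof (rule summable_comparison_test')
    show "summable (\<lambda>i. (1/2)^i * norm e)"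
      by (intro summable_mult2 summable_geometric) simp
    fix i
    have "norm (g k i) \<le> norm (x (k + i)) * norm (U i k)" unfolding g_def by (rule norm_mult_ineq)
    also have "\<dots> \<le> (1/2)^i * norm e"
    proof (intro mult_mono U_le)
      have "norm (x (k + i)) \<le> (1/2)^(k + i)" by (rule x_le)
      also have "\<dots> \<le> (1/2)^i" by (rule power_decreasing) auto
      finally show "norm (x (k + i)) \<le> (1/2)^i" .
    qed auto
    finally show "norm (g k i) \<le> (1/2)^i * norm e" .
  qed
  define b where "b k = suminf (g k)" for k
  have b_rec: "b k = x k + w k * w k * b (Suc k)" for k
  proof -
    have "b k = g k 0 + (\<Sum>i. g k (Suc i))"
      unfolding b_def using suminf_split_head[OF g_sum[of k]] by simp
    also have "(\<lambda>i. g k (Suc i)) = (\<lambda>i. w k * w k * g (Suc k) i)"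
      by (simp add: g_def U ring_simps)
    also have "(\<Sum>i. w k * w k * g (Suc k) i) = w k * w k * b (Suc k)"
      unfolding b_def by (rule suminf_mult[OF g_sum])
    finally show ?thesis by (simp add: g_def U)
  qed
  have b0: "b 0 = s k + V k * b k" for k
  proof (induction k)
    case (Suc k)
    then have "b 0 = s k + V k * (x k + w k * w k * b (Suc k))" by (metis b_rec)
    then show ?case by (simp add: s_Suc V algebra_simps)
  qed (simp add: s0 V)
  have "real k \<le> norm (D (b 0))" for k
  proof -
    have "b 0 = s k + V k * x k + w k * (w k * (V k * b (Suc k)))"
      using b0[of k] unfolding b_rec[of k] by (simp add: ring_simps)
    then have "\<phi> k (D (b 0)) = \<phi> k (D (s k)) + \<phi> k (D (V k * x k)) + \<phi> k (D (w k * (w k * (V k * b (Suc k)))))"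
      by (simp only: derivationD(1)[OF D] characterD(1)[OF ch])
    \<comment> \<open>The square matters: after the product rule every term still contains a factor
      \<open>w k\<close>.\<close>
    also have "\<phi> k (D (w k * (w k * (V k * b (Suc k))))) = 0"
      by (simp add: derivationD(3)[OF D, of "w k"] characterD[OF ch] w0)
    finally have "cmod (\<phi> k (D (V k * x k))) \<le> cmod (\<phi> k (D (b 0))) + cmod (\<phi> k (D (s k)))"
      using norm_triangle_ineq4[of "\<phi> k (D (b 0))" "\<phi> k (D (s k))"] by simp
    then have "real k \<le> cmod (\<phi> k (D (b 0)))" using big[of k] by simp
    also have "\<dots> \<le> norm (D (b 0))" by (rule character_bound[OF ch])
    finally show ?thesis .
  qed
  then show False using reals_Archimedean2 not_less by blast
qed

text \<open>The witness is a product of factors \<open>x - scaleC (\<psi> x) e\<close>, one for each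
  \<open>\<psi>\<close>, with \<open>x\<close> separating \<open>\<psi>\<close> from
  \<open>\<phi>\<close>.\<close>

lemma character_separates_from_finite:
  assumes "finite F" "character \<phi>" "\<And>\<psi>. \<psi> \<in> F \<Longrightarrow> character \<psi> \<and> \<psi> \<noteq> \<phi>"
  shows "\<exists>w. \<phi> w \<noteq> 0 \<and> (\<forall>\<psi>\<in>F. \<psi> w = 0)"
  using assms(1,3)
proof (induction F rule: finite_induct)
  case empty
  show ?case using characterD(4)[OF assms(2)] by (intro exI[of _ e]) simp
next
  case (insert \<psi> F)
  then obtain w where w: "\<phi> w \<noteq> 0" "\<And>\<xi>. \<xi> \<in> F \<Longrightarrow> \<xi> w = 0" by auto
  obtain x where x: "\<phi> x \<noteq> \<psi> x" using insert.prems[of \<psi>] by fastforce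
  have c\<psi>: "character \<psi>" using insert.prems by blast
  let ?v = "(x - scaleC (\<psi> x) e) * w"
  have "\<phi> ?v \<noteq> 0" using w x by (simp add: characterD[OF assms(2)])
  moreover have "\<psi> ?v = 0" by (simp add: characterD[OF c\<psi>])
  moreover have "\<xi> ?v = 0" if "\<xi> \<in> F" for \<xi>
  proof -
    have "character \<xi>" using insert.prems that by blast
    then show ?thesis using w that by (simp add: characterD)
  qed
  ultimately show ?case by blast
qed

text \<open>If the characters outside the finite set \<open>E\<close> of unbounded ones did not separate points, some
  \<open>\<phi> \<in> E\<close> would be isolated by an idempotent \<open>f\<close> with \<open>f A = \<complex> f\<close>; then \<open>f D x = 0\<close>, so \<open>\<phi> \<circ> D = 0\<close>.\<close>

lemma bounded_characters_separate:
  assumes D: "derivation D" and rad: "jacobson_rad \<subseteq> {0::'a}"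
    and y: "\<And>\<phi>. character \<phi> \<Longrightarrow> \<exists>K. \<forall>x. cmod (\<phi> (D x)) \<le> K * norm x \<Longrightarrow> \<phi> y = 0"
  shows "y = 0"
proof (rule ccontr)
  assume "y \<noteq> 0"
  define E where "E = {\<phi>. character \<phi> \<and> \<not> (\<exists>K. \<forall>x. cmod (\<phi> (D x)) \<le> K * norm x)}"
  have zero: "x = 0" if "\<And>\<phi>. character \<phi> \<Longrightarrow> \<phi> x = 0" for x
    using character_separates[OF rad] that by blast
  obtain \<phi> where \<phi>: "character \<phi>" "\<phi> y \<noteq> 0" using character_separates[OF rad \<open>y \<noteq> 0\<close>] by blast
  then have \<phi>E: "\<phi> \<in> E" using y unfolding E_def by blast
  have "finite E" unfolding E_def by (rule finite_unbounded_characters[OF D])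
  then have "\<exists>w. \<phi> w \<noteq> 0 \<and> (\<forall>\<psi>\<in>E - {\<phi>}. \<psi> w = 0)"
    by (intro character_separates_from_finite \<phi>(1)) (auto simp: E_def)
  then obtain w where w: "\<phi> w \<noteq> 0" "\<And>\<psi>. \<psi> \<in> E - {\<phi>} \<Longrightarrow> \<psi> w = 0" by blast
  \<comment> \<open>\<open>w\<close> is killed by the other characters in \<open>E\<close> and
    \<open>y\<close> by those outside \<open>E\<close>, so \<open>f\<close> is the indicator of
    \<open>\<phi>\<close> on the set of characters.\<close>
  define f where "f = scaleC (1 / (\<phi> w * \<phi> y)) (w * y)"
  have f1: "\<phi> f = 1" using \<phi> w by (simp add: f_def characterD[OF \<phi>(1)])
  have f0: "\<psi> f = 0" if "character \<psi>" "\<psi> \<noteq> \<phi>" for \<psi>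
  proof -
    have "\<psi> w = 0 \<or> \<psi> y = 0" using w(2)[of \<psi>] y[of \<psi>] that unfolding E_def by blast
    then show ?thesis by (auto simp: f_def characterD[OF that(1)])
  qed
  have fx: "f * x = scaleC (\<phi> x) f" for x
  proof -
    have "f * x - scaleC (\<phi> x) f = 0"
    proof (rule zero)
      fix \<psi> assume "character \<psi>"
      then show "\<psi> (f * x - scaleC (\<phi> x) f) = 0"
        using f0[of \<psi>] f1 by (cases "\<psi> = \<phi>") (auto simp: characterD)
    qed
    then show ?thesis by simp
  qed
  have "f * f = f" using fx[of f] by (simp add: f1 scaleC_one)
  then have fDf: "f * D f = 0" by (rule derivation_idempotent[OF D])
  have "\<phi> (D x) = 0" for x
  proof -
    \<comment> \<open>Differentiating \<open>f * x = scaleC (\<phi> x) f\<close> and multiplying by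
      \<open>f\<close> isolates \<open>f * D x\<close>.\<close>
    have "f * D (f * x) = scaleC (\<phi> x) (f * D f)"
      by (simp add: fx derivationD[OF D] scaleC_simps)
    then have "f * (D f * x + f * D x) = 0" by (simp add: fDf derivationD[OF D])
    then have "f * D f * x + f * f * D x = 0" by (simp add: algebra_simps)
    then have "f * D x = 0" by (simp add: fDf \<open>f * f = f\<close>)
    then have "\<phi> f * \<phi> (D x) = 0" by (metis characterD(3,5)[OF \<phi>(1)])
    then show ?thesis by (simp add: f1)
  qed
  then have "\<forall>x. cmod (\<phi> (D x)) \<le> 0 * norm x" by simp
  then show False using \<phi>E unfolding E_def by blast
qed

theorem derivation_eq_zero:
  fixes D :: "'a \<Rightarrow> 'a"
  assumes D: "derivation D" and rad: "jacobson_rad \<subseteq> {0::'a}"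
  shows "D x = 0"
proof -
  have "\<exists>K\<ge>0. \<forall>x. norm (D x) \<le> K * norm x"
  proof (rule closed_graph_bounded[OF derivation_linear[OF D]])
    fix X b assume X: "X \<longlonglongrightarrow> 0" and DX: "(\<lambda>n. D (X n)) \<longlonglongrightarrow> b"
    \<comment> \<open>Whenever \<open>\<phi> \<circ> D\<close> is bounded, \<open>\<phi> b\<close>
      is the limit of \<open>\<phi> (D (X n))\<close>, which is 0; such characters separate
      points.\<close>
    show "b = 0"
    proof (rule bounded_characters_separate[OF D rad])
      fix \<phi> assume \<phi>: "character \<phi>" and "\<exists>K. \<forall>x. cmod (\<phi> (D x)) \<le> K * norm x"
      then obtain K where K: "\<And>x. cmod (\<phi> (D x)) \<le> K * norm x" by blast
      have "(\<lambda>n. K * norm (X n)) \<longlonglongrightarrow> 0"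
        by (intro tendsto_mult_right_zero tendsto_norm_zero X)
      then have "(\<lambda>n. \<phi> (D (X n))) \<longlonglongrightarrow> 0"
        by (rule Lim_null_comparison[rotated]) (simp add: K)
      moreover have "(\<lambda>n. \<phi> (D (X n))) \<longlonglongrightarrow> \<phi> b"
      proof (rule Lim_transform_eventually[OF _ always_eventually])
        have "(\<lambda>n. norm (D (X n) - b)) \<longlonglongrightarrow> 0"
          using DX by (simp add: tendsto_norm_zero_iff LIM_zero)
        then have "(\<lambda>n. \<phi> (D (X n) - b)) \<longlonglongrightarrow> 0"
          by (rule Lim_null_comparison[rotated]) (simp add: character_bound[OF \<phi>])
        from tendsto_add[OF this tendsto_const[of "\<phi> b"]]
        show "(\<lambda>n. \<phi> (D (X n) - b) + \<phi> b) \<longlonglongrightarrow> \<phi> b" by simp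
      qed (simp add: characterD[OF \<phi>])
      ultimately show "\<phi> b = 0" using LIMSEQ_unique by blast
    qed
  qed
  then obtain K where K: "K \<ge> 0" "\<And>x. norm (D x) \<le> K * norm x" by blast
  have "\<phi> (D x) = 0" if "character \<phi>" for \<phi>
    by (rule bounded_derivation_character[OF that D K])
  then show ?thesis using character_separates[OF rad] by blast
qed

end

section \<open>The equivalence of the four conditions\<close>

lemma derivation_inner: "derivation (inner_derivation a)"
  by (simp add: derivation_def inner_derivation_def algebra_simps scaleC_simps)

theorem theorem4p3:
  assumes rad_eq: "(jacobson_rad :: 'a::complex_banach_algebra set) = rann"
    and quot_comm: "\<forall>a b::'a. a * b - b * a \<in> jacobson_rad"
    and right_id: "\<exists>e::'a. \<forall>a. a * e = a"
  shows "((\<exists>u::'a. \<forall>a. u * a = a \<and> a * u = a) \<longleftrightarrow> (\<forall>d::'a \<Rightarrow> 'a. derivation d \<longrightarrow> d = (\<lambda>_. 0)))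
       \<and> ((\<forall>d::'a \<Rightarrow> 'a. derivation d \<longrightarrow> d = (\<lambda>_. 0)) \<longleftrightarrow> (\<forall>a::'a. inner_derivation a = (\<lambda>_. 0)))
       \<and> ((\<forall>a::'a. inner_derivation a = (\<lambda>_. 0)) \<longleftrightarrow> (\<forall>a b::'a. a * b = b * a))"
    (is "(?i \<longleftrightarrow> ?ii) \<and> (?ii \<longleftrightarrow> ?iii) \<and> (?iii \<longleftrightarrow> ?iv)")
proof -
  have "?i \<Longrightarrow> ?ii"
  proof (intro allI impI ext)
    fix D :: "'a \<Rightarrow> 'a" and x
    assume ?i and D: "derivation D"
    then obtain u :: 'a where u: "\<And>a. u * a = a" by blast
    \<comment> \<open>A left identity annihilates only 0, so \<open>rann\<close>, and with it the
      radical, is trivial; commutativity of the quotient then becomes commutativity of the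
      algebra.\<close>
    have rad: "jacobson_rad \<subseteq> {0::'a}"
      unfolding rad_eq rann_def using u by (metis (mono_tags, lifting) insertCI mem_Collect_eq subsetI)
    have "a * b - b * a \<in> {0}" for a b :: 'a
      using quot_comm rad by blast
    then interpret unital_comm_banach_algebra u
      using u by unfold_locales simp_all
    show "D x = 0" by (rule derivation_eq_zero[OF D rad])
  qed
  moreover have "?ii \<Longrightarrow> ?iii" using derivation_inner by blast
  moreover have "?iii \<longleftrightarrow> ?iv" by (auto simp: inner_derivation_def fun_eq_iff)
  moreover have "?iv \<Longrightarrow> ?i"
  proof -
    assume ?iv
    moreover obtain u :: 'a where "\<forall>a. a * u = a" using right_id by blast
    ultimately have "\<forall>a. u * a = a \<and> a * u = a" by simp
    then show ?i ..
  qed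
  ultimately show ?thesis by argo
qed

end
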